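(* Let $n\ge 1$. Assume that $1\le p\le \frac{n+1}{n-1}$ if $n\ge 2$, and $1\le p<\infty$ if $n=1$. Then there exists no classical solution $u$ to the problem $$ \begin{cases} \Delta u=0 & \text{in }\mathbb{R}^{n+1}_{++},\\ u>0 & \text{in }\mathbb{R}^{n+1}_{++},\\ u=0 & \text{on }\{x_n=0,\ y\ge 0\},\\ \dfrac{\partial u}{\partial \nu}=u^{p} & \text{on }\{x_n>0,\ y=0\}. \end{cases} $$
   Context: Points of $\mathbb{R}^{n+1}$ are written $(x,y)=(x_1,\dots,x_n,y)$, and $\mathbb{R}^{n+1}_{++}=\{(x_1,\dots,x_n,y)\in\mathbb{R}^{n+1}: x_n>0,\ y>0\}$. Here $\nu$ is the unit outward normal to $\mathbb{R}^{n+1}_{++}$ at $\{x_n>0,\ y=0\}$, so that $\frac{\partial u}{\partial\nu}=-\frac{\partial u}{\partial y}$ there. A classical solution is a function $u\in C^2(\mathbb{R}^{n+1}_{++})\cap C^1(\overline{\mathbb{R}^{n+1}_{++}})$ satisfying all the conditions pointwise. No boundedness of $u$ is assumed. *)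

theory Defs
  imports "HOL-Analysis.Analysis"
begin

text \<open>
  The space of points \<open>(x, y)\<close> is \<open>(real ^ 'n) \<times> real\<close> with \<open>n = CARD('n) \<ge> 1\<close>. Since a finite index
  type has no canonical last element, the coordinate playing the role of \<open>x\<^sub>n\<close> is an explicit index
  \<open>k :: 'n\<close>; theorems are stated for every choice of \<open>k\<close>.
\<close>

definition quarter_space :: "'n::finite \<Rightarrow> ((real ^ 'n) \<times> real) set" where
  "quarter_space k = {(x, y). 0 < x $ k \<and> 0 < y}"

text \<open>Meaningful only where \<open>u\<close> is differentiable; in the definitions below this is at points of an
  open set on which differentiability is required.\<close>

definition partial_deriv ::
    "'a::euclidean_space \<Rightarrow> ('a \<Rightarrow> real) \<Rightarrow> 'a \<Rightarrow> real" where
  "partial_deriv b u z = frechet_derivative u (at z) b"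

text \<open>\<open>C\<^sup>k(\<Omega>)\<close>, intended for open \<open>\<Omega>\<close>. The values of \<open>u\<close> outside \<open>\<Omega>\<close> are then irrelevant.\<close>

fun C_k_on :: "nat \<Rightarrow> ('a::euclidean_space \<Rightarrow> real) \<Rightarrow> 'a set \<Rightarrow> bool" where
  "C_k_on 0 u \<Omega> \<longleftrightarrow> continuous_on \<Omega> u"
| "C_k_on (Suc k) u \<Omega> \<longleftrightarrow>
     (\<forall>z\<in>\<Omega>. u differentiable (at z)) \<and> (\<forall>b\<in>Basis. C_k_on k (partial_deriv b u) \<Omega>)"

text \<open>\<open>C\<^sup>1\<close> up to the boundary of the open set \<open>\<Omega>\<close>: \<open>u\<close> is \<open>C\<^sup>1\<close> in \<open>\<Omega>\<close>, continuous on the closure, and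
  its first partial derivatives extend continuously from \<open>\<Omega>\<close> to the closure.\<close>

definition C1_on_closure :: "('a::euclidean_space \<Rightarrow> real) \<Rightarrow> 'a set \<Rightarrow> bool" where
  "C1_on_closure u \<Omega> \<longleftrightarrow>
     C_k_on 1 u \<Omega> \<and> continuous_on (closure \<Omega>) u \<and>
     (\<forall>b\<in>Basis. \<exists>g. continuous_on (closure \<Omega>) g \<and> (\<forall>z\<in>\<Omega>. g z = partial_deriv b u z))"

definition laplacian :: "('a::euclidean_space \<Rightarrow> real) \<Rightarrow> 'a \<Rightarrow> real" where
  "laplacian u z = (\<Sum>b\<in>Basis. partial_deriv b (partial_deriv b u) z)"

text \<open>The derivative of \<open>u\<close> at the boundary point \<open>z\<close> in the outward direction \<open>\<nu>\<close>. It is one-sided: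
  for \<open>t < 0\<close> the point \<open>z + t \<nu>\<close> lies inside the domain.\<close>

definition has_normal_derivative ::
    "('a::euclidean_space \<Rightarrow> real) \<Rightarrow> real \<Rightarrow> 'a \<Rightarrow> 'a \<Rightarrow> bool" where
  "has_normal_derivative u d \<nu> z \<longleftrightarrow>
     ((\<lambda>t. u (z + t *\<^sub>R \<nu>)) has_real_derivative d) (at_left 0)"

text \<open>The outward unit normal on \<open>{x\<^sub>n > 0, y = 0}\<close> is \<open>(0, -1)\<close>. There \<open>u \<ge> 0\<close> by continuity, and
  \<open>0 powr p = 0\<close>, so \<open>powr\<close> is the usual power for \<open>p \<ge> 1\<close>.\<close>

definition classical_solution ::
    "'n::finite \<Rightarrow> real \<Rightarrow> ((real ^ 'n) \<times> real \<Rightarrow> real) \<Rightarrow> bool" where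
  "classical_solution k p u \<longleftrightarrow>
     C_k_on 2 u (quarter_space k) \<and>
     C1_on_closure u (quarter_space k) \<and>
     (\<forall>z\<in>quarter_space k. laplacian u z = 0) \<and>
     (\<forall>z\<in>quarter_space k. u z > 0) \<and>
     (\<forall>x y. x $ k = 0 \<and> y \<ge> 0 \<longrightarrow> u (x, y) = 0) \<and>
     (\<forall>x. x $ k > 0 \<longrightarrow> has_normal_derivative u (u (x, 0) powr p) (0, -1) (x, 0))"

end

theory Submission imports Defs begin

text \<open>
  The proof is a moving sphere argument in which every sphere is centred at a point \<open>C = (c, 0)\<close> with
  \<open>c\<^sub>k < 0\<close>, that is, outside the domain. For a solution \<open>u\<close> and a radius \<open>l\<close> the Kelvin transform
  \<open>u\<^sub>l\<close> of \<open>u\<close> is harmonic (\<open>has_laplacian_kelvin\<close>), and where \<open>r = dist X C \<le> l\<close> its outward normal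
  derivative on the bottom face is \<open>(l / r)\<close> to the power \<open>n + 1 - p (n - 1)\<close> times \<open>u\<^sub>l\<^sup>p\<close>. The bound on
  \<open>p\<close> says precisely that this exponent is nonnegative, so that \<open>u\<^sub>l\<close> is a supersolution of the boundary
  condition on the cap \<open>r \<le> l\<close> (\<open>kelvin_neumann\<close>). The caps are compact and avoid both the centre and
  infinity, and on the Dirichlet face inside the sphere \<open>u = 0 < u\<^sub>l\<close>. Nothing can therefore stop the
  spheres, and \<open>u \<le> u\<^sub>l\<close> on every cap (\<open>solution_le_kelvin\<close>).

  If \<open>x\<close> and \<open>z\<close> are bottom points with \<open>x\<^sub>k < z\<^sub>k\<close>, a centre far away on the line through them and a
  suitable radius exchange the two points. As the centre recedes the conformal factor tends to \<open>1\<close>,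
  whence \<open>u(x, 0) \<le> u(z, 0)\<close> (\<open>increasing_on_bottom\<close>). Consequently \<open>u \<ge> \<delta> > 0\<close> on the whole part
  \<open>x\<^sub>k > 1\<close> of the bottom, and there the normal derivative \<open>u\<^sup>p\<close> is at least \<open>\<delta>\<^sup>p\<^sup>-\<^sup>1 u\<close>. On a large
  cylinder over this part there is an explicit strictly subharmonic function that vanishes on the
  lateral side and the top and whose normal derivative on the bottom is at most \<open>2\<kappa>\<close> times itself,
  where \<open>2\<kappa> < \<delta>\<^sup>p\<^sup>-\<^sup>1\<close>. The largest multiple of it that lies below \<open>u\<close> touches \<open>u\<close> at a
  point where the maximum principle gives a contradiction (\<open>no_solution\<close>).

  All comparisons use only two facts about the minimum of a function: a Laplacian is nonnegative at an
  interior minimum, and the outward derivative is nonpositive at a minimum on the bottom face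
  (\<open>interior_min_laplacian_nonneg\<close>, \<open>bottom_min_normal_derivative_nonpos\<close>). The strong maximum principle
  and the Hopf lemma are replaced by one comparison with a Gaussian in a spherical shell
  (\<open>positive_on_shell\<close>).
\<close>

section \<open>Laplacians computed along coordinate lines\<close>

definition has_second_derivative :: "(real \<Rightarrow> real) \<Rightarrow> real \<Rightarrow> bool" where
  "has_second_derivative f s \<longleftrightarrow>
     (\<exists>d. (\<forall>\<^sub>F t in nhds 0. (f has_real_derivative d t) (at t)) \<and> (d has_real_derivative s) (at 0))"

text \<open>Maximum principles need nothing but second derivatives along the coordinate lines through one
  point. Encoding the Laplacian that way reduces it to one-variable calculus, both for the
  Kelvin transform and for the explicit comparison functions, with no iterated Frechet derivatives.\<close>

definition has_laplacian :: "('a::euclidean_space \<Rightarrow> real) \<Rightarrow> real \<Rightarrow> 'a \<Rightarrow> bool" where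
  "has_laplacian f L z \<longleftrightarrow>
     (\<exists>s. (\<forall>b\<in>Basis. has_second_derivative (\<lambda>t. f (z + t *\<^sub>R b)) (s b)) \<and> L = sum s Basis)"

lemma has_second_derivativeI:
  assumes "\<And>t. (f has_real_derivative d t) (at t)" "(d has_real_derivative s) (at 0)"
  shows "has_second_derivative f s"
  using assms unfolding has_second_derivative_def by (intro exI[of _ d]) auto

lemma has_second_derivative_lincomb:
  assumes "has_second_derivative f s" "has_second_derivative g r"
  shows "has_second_derivative (\<lambda>t. \<alpha> * f t + \<beta> * g t) (\<alpha> * s + \<beta> * r)"
proof -
  obtain d e where d: "\<forall>\<^sub>F t in nhds 0. (f has_real_derivative d t) (at t)" "(d has_real_derivative s) (at 0)"
    and e: "\<forall>\<^sub>F t in nhds 0. (g has_real_derivative e t) (at t)" "(e has_real_derivative r) (at 0)"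
    using assms unfolding has_second_derivative_def by blast
  have "\<forall>\<^sub>F t in nhds 0. ((\<lambda>t. \<alpha> * f t + \<beta> * g t) has_real_derivative (\<alpha> * d t + \<beta> * e t)) (at t)"
    using d(1) e(1) by eventually_elim (auto intro!: derivative_eq_intros)
  moreover have "((\<lambda>t. \<alpha> * d t + \<beta> * e t) has_real_derivative (\<alpha> * s + \<beta> * r)) (at 0)"
    using d(2) e(2) by (auto intro!: derivative_eq_intros)
  ultimately show ?thesis
    unfolding has_second_derivative_def by (intro exI[of _ "\<lambda>t. \<alpha> * d t + \<beta> * e t"]) auto
qed

lemma has_laplacian_lincomb:
  assumes "has_laplacian f L z" "has_laplacian g K z"
  shows "has_laplacian (\<lambda>x. \<alpha> * f x + \<beta> * g x) (\<alpha> * L + \<beta> * K) z"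
proof -
  obtain s r where s: "\<forall>b\<in>Basis. has_second_derivative (\<lambda>t. f (z + t *\<^sub>R b)) (s b)" "L = sum s Basis"
    and r: "\<forall>b\<in>Basis. has_second_derivative (\<lambda>t. g (z + t *\<^sub>R b)) (r b)" "K = sum r Basis"
    using assms unfolding has_laplacian_def by blast
  show ?thesis
    unfolding has_laplacian_def
  proof (intro exI conjI ballI)
    show "has_second_derivative (\<lambda>t. \<alpha> * f (z + t *\<^sub>R b) + \<beta> * g (z + t *\<^sub>R b)) (\<alpha> * s b + \<beta> * r b)"
      if "b \<in> Basis" for b
      using has_second_derivative_lincomb s(1) r(1) that by blast
    show "\<alpha> * L + \<beta> * K = (\<Sum>b\<in>Basis. \<alpha> * s b + \<beta> * r b)"
      by (simp add: s r sum.distrib sum_distrib_left)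
  qed
qed

lemma has_laplacian_const: "has_laplacian (\<lambda>x. c) 0 z"
proof -
  have "has_second_derivative (\<lambda>t. c) 0"
    by (rule has_second_derivativeI[where d="\<lambda>t. 0"]) auto
  then show ?thesis
    unfolding has_laplacian_def by (intro exI[of _ "\<lambda>b. 0"]) auto
qed

lemma has_second_derivative_min:
  assumes "has_second_derivative f s" "\<forall>\<^sub>F t in nhds 0. f 0 \<le> f t"
  shows "0 \<le> s"
proof (rule ccontr)
  assume "\<not> 0 \<le> s"
  obtain d where d: "\<forall>\<^sub>F t in nhds 0. (f has_real_derivative d t) (at t)" "(d has_real_derivative s) (at 0)"
    using assms unfolding has_second_derivative_def by blast
  obtain e where e: "e > 0" "\<And>t. \<bar>t\<bar> < e \<Longrightarrow> (f has_real_derivative d t) (at t)" "\<And>t. \<bar>t\<bar> < e \<Longrightarrow> f 0 \<le> f t"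
    using eventually_conj[OF d(1) assms(2)] unfolding eventually_nhds_metric dist_real_def by auto
  have d0: "d 0 = 0"
    using DERIV_local_min[of f "d 0" 0 e] e by auto
  obtain h where h: "h > 0" "\<And>t. 0 < t \<Longrightarrow> t < h \<Longrightarrow> d t < 0"
    using DERIV_neg_dec_right[OF d(2)] \<open>\<not> 0 \<le> s\<close> d0 by auto
  define t where "t = min e h / 2"
  have t: "0 < t" "t < e" "t < h" using e h by (auto simp: t_def)
  obtain \<xi> where "0 < \<xi>" "\<xi> < t" "f t - f 0 = (t - 0) * d \<xi>"
    using MVT2[of 0 t f d] t e(2) by force
  moreover have "t * d \<xi> < 0" using h(2)[of \<xi>] t calculation by (intro mult_pos_neg) auto
  ultimately have "f t < f 0" by simp
  then show False using e(3)[of t] t by auto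
qed

lemma has_laplacian_min:
  assumes "has_laplacian f L z" "\<forall>\<^sub>F x in nhds z. f z \<le> f x"
  shows "0 \<le> L"
proof -
  obtain s where s: "\<forall>b\<in>Basis. has_second_derivative (\<lambda>t. f (z + t *\<^sub>R b)) (s b)" "L = sum s Basis"
    using assms unfolding has_laplacian_def by blast
  have "0 \<le> s b" if "b \<in> Basis" for b
  proof (rule has_second_derivative_min)
    show "has_second_derivative (\<lambda>t. f (z + t *\<^sub>R b)) (s b)" using s that by blast
    have "((\<lambda>t::real. z + t *\<^sub>R b) \<longlongrightarrow> z + 0 *\<^sub>R b) (nhds 0)"
      by (intro tendsto_intros filterlim_ident)
    then have "filterlim (\<lambda>t::real. z + t *\<^sub>R b) (nhds z) (nhds 0)" by simp
    from eventually_compose_filterlim[OF assms(2) this]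
    show "\<forall>\<^sub>F t in nhds 0. f (z + 0 *\<^sub>R b) \<le> f (z + t *\<^sub>R b)" by simp
  qed
  then show ?thesis by (simp add: s(2) sum_nonneg)
qed

text \<open>All barriers in the moving sphere argument are linear combinations of such functions: Gaussians,
  and exponentials of affine functions when \<open>\<sigma> = 0\<close>.\<close>

lemma has_laplacian_exp_quadratic:
  fixes z v c :: "'a::euclidean_space"
  shows "has_laplacian (\<lambda>x. exp (\<alpha> + v \<bullet> x + \<sigma> * ((x - c) \<bullet> (x - c))))
    (((norm (v + (2 * \<sigma>) *\<^sub>R (z - c)))\<^sup>2 + 2 * \<sigma> * DIM('a)) *
      exp (\<alpha> + v \<bullet> z + \<sigma> * ((z - c) \<bullet> (z - c)))) z"
proof -
  define g where "g = v + (2 * \<sigma>) *\<^sub>R (z - c)"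
  define Q where "Q = \<alpha> + v \<bullet> z + \<sigma> * ((z - c) \<bullet> (z - c))"
  have line: "\<alpha> + v \<bullet> (z + t *\<^sub>R b) + \<sigma> * ((z + t *\<^sub>R b - c) \<bullet> (z + t *\<^sub>R b - c))
      = Q + t * (g \<bullet> b) + \<sigma> * t\<^sup>2" if "b \<in> Basis" for t b
  proof -
    define w where "w = z - c"
    have w: "z + t *\<^sub>R b - c = w + t *\<^sub>R b" by (simp add: w_def)
    have sq: "(w + t *\<^sub>R b) \<bullet> (w + t *\<^sub>R b) = w \<bullet> w + 2 * t * (w \<bullet> b) + t\<^sup>2"
      using that by (simp add: inner_simps inner_commute[of b w] power2_eq_square algebra_simps)
    have "g \<bullet> b = v \<bullet> b + 2 * \<sigma> * (w \<bullet> b)"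
      by (simp add: g_def w_def inner_add_left)
    then show ?thesis
      unfolding w sq by (simp add: Q_def w_def[symmetric] inner_add_right algebra_simps)
  qed
  show ?thesis
    unfolding has_laplacian_def
  proof (intro exI conjI ballI)
    show "has_second_derivative (\<lambda>t. exp (\<alpha> + v \<bullet> (z + t *\<^sub>R b) + \<sigma> * ((z + t *\<^sub>R b - c) \<bullet> (z + t *\<^sub>R b - c))))
        (((g \<bullet> b)\<^sup>2 + 2 * \<sigma>) * exp Q)" if "b \<in> Basis" for b
      unfolding line[OF that]
      by (rule has_second_derivativeI[where d="\<lambda>t. (g \<bullet> b + 2 * \<sigma> * t) * exp (Q + t * (g \<bullet> b) + \<sigma> * t\<^sup>2)"])
        (auto intro!: derivative_eq_intros simp: algebra_simps power2_eq_square)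
    have "(norm g)\<^sup>2 = (\<Sum>b\<in>Basis. (g \<bullet> b)\<^sup>2)"
      unfolding power2_norm_eq_inner by (subst euclidean_inner) (simp add: power2_eq_square)
    then show "((norm (v + (2 * \<sigma>) *\<^sub>R (z - c)))\<^sup>2 + 2 * \<sigma> * DIM('a)) *
      exp (\<alpha> + v \<bullet> z + \<sigma> * ((z - c) \<bullet> (z - c))) = (\<Sum>b\<in>Basis. ((g \<bullet> b)\<^sup>2 + 2 * \<sigma>) * exp Q)"
      unfolding Q_def[symmetric] g_def[symmetric]
      by (simp add: sum.distrib flip: sum_distrib_right)
  qed
qed

lemma has_laplacian_of_hessian:
  fixes f :: "'a::euclidean_space \<Rightarrow> real"
  assumes G: "\<forall>\<^sub>F y in nhds z. (f has_derivative (\<lambda>h. G y \<bullet> h)) (at y)"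
    and H: "(G has_derivative H) (at z)"
  shows "has_laplacian f (\<Sum>b\<in>Basis. H b \<bullet> b) z"
proof -
  have "has_second_derivative (\<lambda>t. f (z + t *\<^sub>R b)) (H b \<bullet> b)" for b
    unfolding has_second_derivative_def
  proof (intro exI[of _ "\<lambda>t. G (z + t *\<^sub>R b) \<bullet> b"] conjI)
    have lin: "linear H" using H by (rule has_derivative_linear)
    have line: "((\<lambda>t. z + t *\<^sub>R b) has_derivative (\<lambda>t. t *\<^sub>R b)) (at t)" for t
      by (auto intro!: derivative_eq_intros)
    have "((\<lambda>t::real. z + t *\<^sub>R b) \<longlongrightarrow> z + 0 *\<^sub>R b) (nhds 0)"
      by (intro tendsto_intros filterlim_ident)
    then have "filterlim (\<lambda>t::real. z + t *\<^sub>R b) (nhds z) (nhds 0)" by simp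
    from eventually_compose_filterlim[OF G this]
    show "\<forall>\<^sub>F t in nhds 0. ((\<lambda>t. f (z + t *\<^sub>R b)) has_real_derivative G (z + t *\<^sub>R b) \<bullet> b) (at t)"
    proof eventually_elim
      case (elim t)
      have "(\<lambda>h. G (z + t *\<^sub>R b) \<bullet> h) \<circ> (\<lambda>h. h *\<^sub>R b) = (*) (G (z + t *\<^sub>R b) \<bullet> b)"
        by (simp add: fun_eq_iff)
      with diff_chain_at[OF line elim] show ?case
        unfolding has_field_derivative_def by (simp add: o_def[of f])
    qed
    have "(G has_derivative H) (at (z + 0 *\<^sub>R b))" using H by simp
    from diff_chain_at[OF line this]
    have "((\<lambda>t. G (z + t *\<^sub>R b)) has_derivative (\<lambda>t. H (t *\<^sub>R b))) (at 0)"
      by (simp add: o_def)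
    from has_derivative_inner_left[OF this, of b]
    have "((\<lambda>t. G (z + t *\<^sub>R b) \<bullet> b) has_derivative (\<lambda>t. H (t *\<^sub>R b) \<bullet> b)) (at 0)" .
    moreover have "(\<lambda>t. H (t *\<^sub>R b) \<bullet> b) = (*) (H b \<bullet> b)"
      by (simp add: fun_eq_iff linear_scale[OF lin])
    ultimately show "((\<lambda>t. G (z + t *\<^sub>R b) \<bullet> b) has_real_derivative H b \<bullet> b) (at 0)"
      unfolding has_field_derivative_def by simp
  qed
  then show ?thesis unfolding has_laplacian_def by (intro exI[of _ "\<lambda>b. H b \<bullet> b"]) simp
qed

section \<open>Harmonicity of the Kelvin transform\<close>

text \<open>The weight is the power of the conformal factor of the inversion that preserves harmonicity; in the
  plane it is \<open>1\<close>.\<close>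

definition kelvin :: "'a::euclidean_space \<Rightarrow> real \<Rightarrow> ('a \<Rightarrow> real) \<Rightarrow> 'a \<Rightarrow> real" where
  "kelvin c l f x = (l / norm (x - c)) ^ (DIM('a) - 2) * f (c + (l\<^sup>2 / (norm (x - c))\<^sup>2) *\<^sub>R (x - c))"

text \<open>Write \<open>R = x - c\<close>, \<open>q = R \<bullet> R\<close>, and let \<open>A\<close> be the conformal factor and \<open>\<gamma>\<close> the inversion along a
  coordinate line. The derivative of the inversion is \<open>l\<^sup>2 / q\<close> times a reflection, which preserves the
  trace of the Hessian (\<open>S4\<close>). The remaining terms vanish because \<open>A\<close> is itself harmonic
  (\<open>S1\<close>) and because the cross term of \<open>A\<close> with \<open>\<gamma>\<close> (\<open>S2\<close>) cancels the Laplacian of the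
  inversion (\<open>S3\<close>).\<close>

lemma has_laplacian_kelvin:
  fixes f :: "'a::euclidean_space \<Rightarrow> real"
  assumes dim: "2 \<le> DIM('a)" and l: "0 < l" and xc: "x \<noteq> c"
    and z: "z = c + (l\<^sup>2 / (norm (x - c))\<^sup>2) *\<^sub>R (x - c)"
    and G: "\<forall>\<^sub>F y in nhds z. (f has_derivative (\<lambda>h. G y \<bullet> h)) (at y)"
    and H: "(G has_derivative H) (at z)"
    and harmonic: "(\<Sum>b\<in>Basis. H b \<bullet> b) = 0"
  shows "has_laplacian (kelvin c l f) 0 x"
proof -
  define R where "R = x - c"
  define q where "q = R \<bullet> R"
  define m where "m = real (DIM('a) - 2)"
  define K where "K = l ^ (DIM('a) - 2)"
  have q: "q > 0" using xc by (simp add: q_def R_def)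
  define \<rho> where "\<rho> b t = q + 2 * t * (R \<bullet> b) + t\<^sup>2" for b and t :: real
  define A where "A b t = K * \<rho> b t powr (- m / 2)" for b t
  define \<gamma> where "\<gamma> b t = c + (l\<^sup>2 / \<rho> b t) *\<^sub>R (R + t *\<^sub>R b)" for b t
  define A' where "A' b t = - m * (R \<bullet> b + t) / \<rho> b t * A b t" for b t
  define \<gamma>' where "\<gamma>' b t = l\<^sup>2 *\<^sub>R ((1 / \<rho> b t) *\<^sub>R b - (2 * (R \<bullet> b + t) / (\<rho> b t)\<^sup>2) *\<^sub>R (R + t *\<^sub>R b))" for b t
  have linear: "linear H" using H by (rule has_derivative_linear)
  define A0 where "A0 = K * q powr (- m / 2)"
  define B1 where "B1 b = (- m * (R \<bullet> b) / q * A0)" for b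
  define B2 where "B2 b = ((m\<^sup>2 + 2 * m) * (R \<bullet> b)\<^sup>2 / q\<^sup>2 - m / q) * A0" for b
  define g1 where "g1 b = (l\<^sup>2 / q) *\<^sub>R (b - (2 * (R \<bullet> b) / q) *\<^sub>R R)" for b
  define g2 where "g2 b = l\<^sup>2 *\<^sub>R ((- 4 * (R \<bullet> b) / q\<^sup>2) *\<^sub>R b + (8 * (R \<bullet> b)\<^sup>2 / q ^ 3 - 2 / q\<^sup>2) *\<^sub>R R)" for b
  define s where "s b = B2 b * f z + 2 * B1 b * (G z \<bullet> g1 b) + A0 * (H (g1 b) \<bullet> g1 b + G z \<bullet> g2 b)" for b
  have kel: "kelvin c l f (x + t *\<^sub>R b) = A b t * f (\<gamma> b t)" if "b \<in> Basis" "\<rho> b t > 0" for b t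
  proof -
    have n2: "(norm (x + t *\<^sub>R b - c))\<^sup>2 = \<rho> b t"
    proof -
      have "x + t *\<^sub>R b - c = R + t *\<^sub>R b" by (simp add: R_def)
      show ?thesis
        using that(1) unfolding \<open>x + t *\<^sub>R b - c = R + t *\<^sub>R b\<close> \<rho>_def q_def power2_norm_eq_inner
        by (simp add: inner_simps inner_commute[of b R] power2_eq_square algebra_simps)
    qed
    have "norm (x + t *\<^sub>R b - c) = sqrt (\<rho> b t)" by (simp flip: n2)
    also have "\<dots> = \<rho> b t powr (1/2)" using that by (simp add: powr_half_sqrt)
    finally have nrm: "norm (x + t *\<^sub>R b - c) = \<rho> b t powr (1/2)" .
    have "(l / norm (x + t *\<^sub>R b - c)) ^ (DIM('a) - 2) = K * (inverse (\<rho> b t powr (1/2))) ^ (DIM('a) - 2)"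
      unfolding nrm K_def by (simp only: divide_inverse power_mult_distrib)
    also have "inverse (\<rho> b t powr (1/2)) = \<rho> b t powr (- 1/2)" by (simp add: powr_minus)
    also have "(\<rho> b t powr (- 1/2)) ^ (DIM('a) - 2) = \<rho> b t powr (- m / 2)"
      using that by (subst powr_realpow[symmetric]) (auto simp: powr_powr m_def)
    finally show ?thesis
      unfolding kelvin_def A_def \<gamma>_def n2 by (simp add: R_def algebra_simps)
  qed
  have sd: "has_second_derivative (\<lambda>t. kelvin c l f (x + t *\<^sub>R b)) (s b)" if b: "b \<in> Basis" for b
  proof -
    have bb: "b \<bullet> b = 1" using b by simp
    have d\<rho>: "(\<rho> b has_real_derivative 2 * (R \<bullet> b + t)) (at t)" for t
      unfolding \<rho>_def by (auto intro!: derivative_eq_intros)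
    have dA: "(A b has_real_derivative A' b t) (at t)" if "\<rho> b t > 0" for t
    proof -
      have "((\<lambda>t. K * \<rho> b t powr (- m / 2)) has_real_derivative
          K * ((- m / 2) * \<rho> b t powr (- m / 2 - 1) * (2 * (R \<bullet> b + t)))) (at t)"
        using d\<rho> that by (auto intro!: derivative_eq_intros)
      moreover have "\<rho> b t powr (- m / 2 - 1) = \<rho> b t powr (- m / 2) / \<rho> b t"
        using that by (subst powr_diff) simp
      with that have "K * ((- m / 2) * \<rho> b t powr (- m / 2 - 1) * (2 * (R \<bullet> b + t))) = A' b t"
        by (simp add: A'_def A_def field_simps)
      ultimately show ?thesis
        unfolding A_def[abs_def] by simp
    qed
    have d\<gamma>: "(\<gamma> b has_vector_derivative \<gamma>' b t) (at t)" if "\<rho> b t > 0" for t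
    proof -
      have "((\<lambda>t. l\<^sup>2 / \<rho> b t) has_real_derivative - (l\<^sup>2 * (2 * (R \<bullet> b + t))) / (\<rho> b t)\<^sup>2) (at t)"
        using d\<rho>[of t] that by (auto intro!: derivative_eq_intros simp: power2_eq_square)
      moreover have "((\<lambda>t. R + t *\<^sub>R b) has_vector_derivative b) (at t)"
        by (auto intro!: derivative_eq_intros)
      ultimately have "((\<lambda>t. (l\<^sup>2 / \<rho> b t) *\<^sub>R (R + t *\<^sub>R b)) has_vector_derivative
          (l\<^sup>2 / \<rho> b t) *\<^sub>R b + (- (l\<^sup>2 * (2 * (R \<bullet> b + t))) / (\<rho> b t)\<^sup>2) *\<^sub>R (R + t *\<^sub>R b)) (at t)"
        by (rule has_vector_derivative_scaleR)
      from has_vector_derivative_add[OF has_vector_derivative_const[of c] this]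
      show ?thesis unfolding \<gamma>_def[abs_def] \<gamma>'_def
        by (simp add: scaleR_diff_right)
    qed
    have \<rho>0: "\<rho> b 0 = q" and \<gamma>0: "\<gamma> b 0 = z"
      by (auto simp: \<rho>_def \<gamma>_def z R_def q_def power2_norm_eq_inner)
    have "isCont (\<rho> b) 0" using d\<rho> DERIV_isCont by blast
    then have "(\<rho> b \<longlongrightarrow> \<rho> b 0) (nhds 0)" unfolding isCont_def tendsto_at_iff_tendsto_nhds .
    then have ev: "\<forall>\<^sub>F t in nhds 0. \<rho> b t > 0"
      using q \<rho>0 order_tendstoD(1) by fastforce
    have "isCont (\<gamma> b) 0"
      using d\<gamma>[of 0] \<rho>0 q by (simp add: has_vector_derivative_continuous)
    then have "filterlim (\<gamma> b) (nhds z) (nhds 0)"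
      using \<gamma>0 unfolding isCont_def tendsto_at_iff_tendsto_nhds by simp
    from eventually_compose_filterlim[OF G this]
    have evG: "\<forall>\<^sub>F t in nhds 0. (f has_derivative (\<lambda>h. G (\<gamma> b t) \<bullet> h)) (at (\<gamma> b t))" .
    have df: "((\<lambda>t. f (\<gamma> b t)) has_real_derivative G (\<gamma> b t) \<bullet> \<gamma>' b t) (at t)"
      if "\<rho> b t > 0" "(f has_derivative (\<lambda>h. G (\<gamma> b t) \<bullet> h)) (at (\<gamma> b t))" for t
    proof -
      have "(\<gamma> b has_derivative (\<lambda>h. h *\<^sub>R \<gamma>' b t)) (at t)"
        using d\<gamma>[OF that(1)] by (simp add: has_vector_derivative_def)
      note chain = diff_chain_at[OF this that(2)]
      have "(\<lambda>h. G (\<gamma> b t) \<bullet> h) \<circ> (\<lambda>h. h *\<^sub>R \<gamma>' b t) = (*) (G (\<gamma> b t) \<bullet> \<gamma>' b t)"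
        by (simp add: fun_eq_iff)
      with chain show ?thesis
        unfolding has_field_derivative_def by (simp add: o_def[of f])
    qed
    have first: "\<forall>\<^sub>F t in nhds 0. ((\<lambda>t. kelvin c l f (x + t *\<^sub>R b)) has_real_derivative
       (A' b t * f (\<gamma> b t) + A b t * (G (\<gamma> b t) \<bullet> \<gamma>' b t))) (at t)"
    proof -
      have "\<forall>\<^sub>F t in nhds 0. \<forall>\<^sub>F s in nhds t. \<rho> b s > 0"
        using ev by (simp add: eventually_eventually)
      then show ?thesis
        using evG ev
      proof eventually_elim
        case (elim t)
        have "((\<lambda>t. A b t * f (\<gamma> b t)) has_real_derivative
           (A' b t * f (\<gamma> b t) + A b t * (G (\<gamma> b t) \<bullet> \<gamma>' b t))) (at t)"
          using DERIV_mult[OF dA df] elim by (simp add: mult.commute add.commute)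
        moreover have "\<forall>\<^sub>F s in nhds t. A b s * f (\<gamma> b s) = kelvin c l f (x + s *\<^sub>R b)"
          using elim(1) by eventually_elim (simp add: kel b)
        ultimately show ?case
          by (simp add: DERIV_cong_ev)
      qed
    qed
    have A0: "A b 0 = A0" and A'0: "A' b 0 = B1 b" by (auto simp: A_def A'_def \<rho>0 A0_def B1_def)
    have \<gamma>'0: "\<gamma>' b 0 = g1 b"
      using q by (simp add: \<gamma>'_def \<rho>0 g1_def algebra_simps power2_eq_square)
    have f0: "(f has_derivative (\<lambda>h. G z \<bullet> h)) (at z)" using eventually_nhds_x_imp_x[OF G] .
    have df0: "((\<lambda>t. f (\<gamma> b t)) has_real_derivative G z \<bullet> g1 b) (at 0)"
      using df[of 0] \<rho>0 q f0 \<gamma>0 \<gamma>'0 by simp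
    have dA0: "(A b has_real_derivative B1 b) (at 0)" using dA[of 0] \<rho>0 q A'0 by simp
    have dA'0: "(A' b has_real_derivative B2 b) (at 0)"
    proof -
      have "((\<lambda>t. - m * (R \<bullet> b + t) / \<rho> b t * A b t) has_real_derivative B2 b) (at 0)"
        using q by (auto intro!: derivative_eq_intros d\<rho> dA0 simp: \<rho>0 A0 B1_def B2_def field_simps power2_eq_square)
      then show ?thesis unfolding A'_def[abs_def] .
    qed
    have d\<gamma>0: "(\<gamma> b has_derivative (\<lambda>h. h *\<^sub>R g1 b)) (at 0)"
      using d\<gamma>[of 0] \<rho>0 q \<gamma>'0 by (simp add: has_vector_derivative_def)
    have dG0: "((\<lambda>t. G (\<gamma> b t)) has_vector_derivative H (g1 b)) (at 0)"
    proof -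
      have "(G has_derivative H) (at (\<gamma> b 0))" using H \<gamma>0 by simp
      from diff_chain_at[OF d\<gamma>0 this] show ?thesis
        using linear_scale[OF linear] by (simp add: has_vector_derivative_def o_def)
    qed
    have d\<gamma>'0: "(\<gamma>' b has_vector_derivative g2 b) (at 0)"
    proof -
      have d1: "((\<lambda>t. 1 / \<rho> b t) has_real_derivative - 2 * (R \<bullet> b) / q\<^sup>2) (at 0)"
        using q by (auto intro!: derivative_eq_intros d\<rho> simp: \<rho>0 power2_eq_square)
      have d2: "((\<lambda>t. 2 * (R \<bullet> b + t) / (\<rho> b t)\<^sup>2) has_real_derivative (2 / q\<^sup>2 - 8 * (R \<bullet> b)\<^sup>2 / q ^ 3)) (at 0)"
        using q by (auto intro!: derivative_eq_intros d\<rho> simp: \<rho>0 field_simps eval_nat_numeral)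
      have d3: "((\<lambda>t. R + t *\<^sub>R b) has_vector_derivative b) (at 0)"
        by (auto intro!: derivative_eq_intros)
      have d4: "((\<lambda>t. (2 * (R \<bullet> b + t) / (\<rho> b t)\<^sup>2) *\<^sub>R (R + t *\<^sub>R b)) has_vector_derivative
         (2 * (R \<bullet> b) / q\<^sup>2) *\<^sub>R b + (2 / q\<^sup>2 - 8 * (R \<bullet> b)\<^sup>2 / q ^ 3) *\<^sub>R R) (at 0)"
        using has_vector_derivative_scaleR[OF d2 d3] by (simp add: \<rho>0)
      have d5: "((\<lambda>t. (1 / \<rho> b t) *\<^sub>R b) has_vector_derivative (- 2 * (R \<bullet> b) / q\<^sup>2) *\<^sub>R b) (at 0)"
        using has_vector_derivative_scaleR[OF d1 has_vector_derivative_const[of b]] by simp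
      have "((\<lambda>t. l\<^sup>2 *\<^sub>R ((1 / \<rho> b t) *\<^sub>R b - (2 * (R \<bullet> b + t) / (\<rho> b t)\<^sup>2) *\<^sub>R (R + t *\<^sub>R b)))
        has_vector_derivative l\<^sup>2 *\<^sub>R ((- 2 * (R \<bullet> b) / q\<^sup>2) *\<^sub>R b -
          ((2 * (R \<bullet> b) / q\<^sup>2) *\<^sub>R b + (2 / q\<^sup>2 - 8 * (R \<bullet> b)\<^sup>2 / q ^ 3) *\<^sub>R R))) (at 0)"
        using bounded_linear.has_vector_derivative[OF bounded_linear_scaleR_right has_vector_derivative_diff[OF d5 d4]] by blast
      moreover have "l\<^sup>2 *\<^sub>R ((- 2 * (R \<bullet> b) / q\<^sup>2) *\<^sub>R b -
          ((2 * (R \<bullet> b) / q\<^sup>2) *\<^sub>R b + (2 / q\<^sup>2 - 8 * (R \<bullet> b)\<^sup>2 / q ^ 3) *\<^sub>R R)) = g2 b"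
        by (simp add: g2_def algebra_simps flip: scaleR_add_left)
      ultimately show ?thesis unfolding \<gamma>'_def[abs_def] by simp
    qed
    have dGg: "((\<lambda>t. G (\<gamma> b t) \<bullet> \<gamma>' b t) has_real_derivative (G z \<bullet> g2 b + H (g1 b) \<bullet> g1 b)) (at 0)"
      using bounded_bilinear.has_vector_derivative[OF bounded_bilinear_inner dG0 d\<gamma>'0]
      by (simp add: \<gamma>0 \<gamma>'0 has_real_derivative_iff_has_vector_derivative)
    have "((\<lambda>t. A' b t * f (\<gamma> b t) + A b t * (G (\<gamma> b t) \<bullet> \<gamma>' b t)) has_real_derivative s b) (at 0)"
      by (auto intro!: derivative_eq_intros dA'0 df0 dA0 dGg simp: A0 A'0 \<gamma>0 \<gamma>'0 s_def algebra_simps)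
    then show ?thesis using first unfolding has_second_derivative_def
      by (intro exI[of _ "\<lambda>t. A' b t * f (\<gamma> b t) + A b t * (G (\<gamma> b t) \<bullet> \<gamma>' b t)"]) simp
  qed
  have sumR: "(\<Sum>b\<in>Basis. (R \<bullet> b)\<^sup>2) = q"
    by (simp add: q_def euclidean_inner[of R R] power2_eq_square)
  have repR: "(\<Sum>b\<in>Basis. (R \<bullet> b) *\<^sub>R b) = R" by (rule euclidean_representation)
  have N: "real DIM('a) = m + 2" using dim by (simp add: m_def)
  have S1: "(\<Sum>b\<in>Basis. B2 b) = 0"
  proof -
    have "(\<Sum>b\<in>Basis. B2 b) = ((m\<^sup>2 + 2 * m) * (\<Sum>b\<in>Basis. (R \<bullet> b)\<^sup>2) / q\<^sup>2 - real DIM('a) * (m / q)) * A0"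
      unfolding B2_def by (simp add: sum_subtractf sum_distrib_left flip: sum_distrib_right sum_divide_distrib)
    then show ?thesis unfolding sumR N using q by (simp add: field_simps power2_eq_square)
  qed
  have S2: "(\<Sum>b\<in>Basis. (2 * B1 b) *\<^sub>R g1 b) = (2 * m * A0 * l\<^sup>2 / q\<^sup>2) *\<^sub>R R"
  proof -
    have "(2 * B1 b) *\<^sub>R g1 b = (- 2 * m * A0 * l\<^sup>2 / q\<^sup>2) *\<^sub>R ((R \<bullet> b) *\<^sub>R b - (2 * (R \<bullet> b)\<^sup>2 / q) *\<^sub>R R)" for b
      using q by (simp add: B1_def g1_def algebra_simps power2_eq_square)
    then have "(\<Sum>b\<in>Basis. (2 * B1 b) *\<^sub>R g1 b) = (- 2 * m * A0 * l\<^sup>2 / q\<^sup>2) *\<^sub>R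
        ((\<Sum>b\<in>Basis. (R \<bullet> b) *\<^sub>R b) - (2 * (\<Sum>b\<in>Basis. (R \<bullet> b)\<^sup>2) / q) *\<^sub>R R)"
      by (simp only: scaleR_sum_right[symmetric] sum_subtractf scaleR_sum_left[symmetric] sum_divide_distrib[symmetric] sum_distrib_left[symmetric])
    also have "\<dots> = (- 2 * m * A0 * l\<^sup>2 / q\<^sup>2) *\<^sub>R (R - 2 *\<^sub>R R)"
      unfolding sumR repR using q by simp
    also have "R - 2 *\<^sub>R R = - R" by (simp add: scaleR_2)
    finally show ?thesis by simp
  qed
  have S3: "(\<Sum>b\<in>Basis. g2 b) = (- 2 * m * l\<^sup>2 / q\<^sup>2) *\<^sub>R R"
  proof -
    have "g2 b = l\<^sup>2 *\<^sub>R ((- 4 / q\<^sup>2) *\<^sub>R ((R \<bullet> b) *\<^sub>R b) + ((8 / q ^ 3) * (R \<bullet> b)\<^sup>2 - 2 / q\<^sup>2) *\<^sub>R R)" for b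
      by (simp add: g2_def)
    then have "(\<Sum>b\<in>Basis. g2 b) = l\<^sup>2 *\<^sub>R ((- 4 / q\<^sup>2) *\<^sub>R (\<Sum>b\<in>Basis. (R \<bullet> b) *\<^sub>R b)
        + ((8 / q ^ 3) * (\<Sum>b\<in>Basis. (R \<bullet> b)\<^sup>2) - real DIM('a) * (2 / q\<^sup>2)) *\<^sub>R R)"
      by (simp only: scaleR_sum_right[symmetric] sum.distrib sum_subtractf scaleR_sum_left[symmetric] sum_distrib_left[symmetric] sum_constant)
    also have "\<dots> = (l\<^sup>2 * (- 4 / q\<^sup>2 + ((8 / q ^ 3) * q - (m + 2) * (2 / q\<^sup>2)))) *\<^sub>R R"
      unfolding sumR repR N by (simp add: algebra_simps)
    also have "l\<^sup>2 * (- 4 / q\<^sup>2 + ((8 / q ^ 3) * q - (m + 2) * (2 / q\<^sup>2))) = - 2 * m * l\<^sup>2 / q\<^sup>2"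
      using q by (simp add: field_simps eval_nat_numeral)
    finally show ?thesis .
  qed
  have S4: "(\<Sum>b\<in>Basis. H (g1 b) \<bullet> g1 b) = 0"
  proof -
    have "H (g1 b) \<bullet> g1 b = (l\<^sup>2 / q)\<^sup>2 * (H b \<bullet> b - (2 / q) * (((R \<bullet> b) *\<^sub>R H b) \<bullet> R)
        - (2 / q) * (H R \<bullet> ((R \<bullet> b) *\<^sub>R b)) + (4 / q\<^sup>2) * (H R \<bullet> R) * (R \<bullet> b)\<^sup>2)" for b
      unfolding g1_def linear_scale[OF linear] linear_diff[OF linear]
      by (simp add: inner_simps algebra_simps power2_eq_square)
    then have "(\<Sum>b\<in>Basis. H (g1 b) \<bullet> g1 b) = (l\<^sup>2 / q)\<^sup>2 * ((\<Sum>b\<in>Basis. H b \<bullet> b)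
        - (2 / q) * ((\<Sum>b\<in>Basis. (R \<bullet> b) *\<^sub>R H b) \<bullet> R)
        - (2 / q) * (H R \<bullet> (\<Sum>b\<in>Basis. (R \<bullet> b) *\<^sub>R b)) + (4 / q\<^sup>2) * (H R \<bullet> R) * (\<Sum>b\<in>Basis. (R \<bullet> b)\<^sup>2))"
      by (simp only: sum_distrib_left[symmetric] sum.distrib sum_subtractf inner_sum_left[symmetric] inner_sum_right[symmetric])
    moreover have "(\<Sum>b\<in>Basis. (R \<bullet> b) *\<^sub>R H b) = H R"
    proof -
      have "H R = H (\<Sum>b\<in>Basis. (R \<bullet> b) *\<^sub>R b)" by (simp add: repR)
      then show ?thesis by (simp add: linear_sum[OF linear] linear_scale[OF linear])
    qed
    ultimately show ?thesis
      unfolding harmonic sumR repR using q by (simp add: field_simps power2_eq_square)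
  qed
  have "(\<Sum>b\<in>Basis. s b) = (\<Sum>b\<in>Basis. B2 b) * f z + G z \<bullet> (\<Sum>b\<in>Basis. (2 * B1 b) *\<^sub>R g1 b)
      + A0 * ((\<Sum>b\<in>Basis. H (g1 b) \<bullet> g1 b) + G z \<bullet> (\<Sum>b\<in>Basis. g2 b))"
    unfolding s_def
    by (simp add: sum.distrib sum_distrib_left sum_distrib_right inner_sum_right algebra_simps)
  also have "\<dots> = 0"
    unfolding S1 S2 S3 S4 by simp
  finally show ?thesis
    unfolding has_laplacian_def using sd by (intro exI[of _ s]) auto
qed

section \<open>The quarter space\<close>

definition closed_quarter :: "'n::finite \<Rightarrow> ((real ^ 'n) \<times> real) set" where
  "closed_quarter k = {(x, y). 0 \<le> x $ k \<and> 0 \<le> y}"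

lemma mem_closed_quarter: "X \<in> closed_quarter k \<longleftrightarrow> 0 \<le> fst X $ k \<and> 0 \<le> snd X"
  by (cases X) (simp add: closed_quarter_def)

lemma mem_quarter_space: "X \<in> quarter_space k \<longleftrightarrow> 0 < fst X $ k \<and> 0 < snd X"
  by (cases X) (simp add: quarter_space_def)

lemma quarter_space_Times: "quarter_space k = {x. 0 < x $ k} \<times> {0<..}"
  by (auto simp: quarter_space_def)

lemma open_quarter_space: "open (quarter_space k)"
  unfolding quarter_space_Times
  by (intro open_Times open_Collect_less continuous_intros open_greaterThan)

lemma convex_quarter_space: "convex (quarter_space k)"
proof -
  have "convex {x::real^'n. axis k 1 \<bullet> x > 0}" for k :: "'n::finite"
    by (rule convex_halfspace_gt)
  then show ?thesis
    unfolding quarter_space_Times by (intro convex_Times) (auto simp: inner_axis')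
qed

lemma closure_quarter_space: "closure (quarter_space k) = closed_quarter k"
proof -
  have "closure {x::real^'n. axis k 1 \<bullet> x > 0} = {x. axis k 1 \<bullet> x \<ge> 0}" for k :: "'n::finite"
    by (rule closure_halfspace_gt) simp
  then show ?thesis
    unfolding quarter_space_Times closure_Times by (auto simp: inner_axis' closed_quarter_def)
qed

lemma closed_closed_quarter: "closed (closed_quarter k)"
  by (metis closed_closure closure_quarter_space)

section \<open>Gradients and differentiability up to the boundary\<close>

definition gradient :: "('a::euclidean_space \<Rightarrow> real) \<Rightarrow> 'a \<Rightarrow> 'a" where
  "gradient u z = (\<Sum>b\<in>Basis. partial_deriv b u z *\<^sub>R b)"

lemma has_derivative_gradient:
  assumes "u differentiable (at z)"
  shows "(u has_derivative (\<lambda>h. gradient u z \<bullet> h)) (at z)"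
proof -
  have D: "(u has_derivative frechet_derivative u (at z)) (at z)"
    using assms by (simp add: frechet_derivative_works)
  have "frechet_derivative u (at z) h = gradient u z \<bullet> h" for h
  proof -
    have lin: "linear (frechet_derivative u (at z))" using D by (rule has_derivative_linear)
    have "frechet_derivative u (at z) h = frechet_derivative u (at z) (\<Sum>b\<in>Basis. (h \<bullet> b) *\<^sub>R b)"
      by (simp add: euclidean_representation)
    also have "\<dots> = (\<Sum>b\<in>Basis. (h \<bullet> b) * partial_deriv b u z)"
      by (simp add: linear_sum[OF lin] linear_scale[OF lin] partial_deriv_def)
    also have "\<dots> = gradient u z \<bullet> h"
      unfolding gradient_def inner_sum_left by (intro sum.cong) (auto simp: inner_commute)
    finally show ?thesis .
  qed
  then show ?thesis using D by (metis (no_types, lifting) ext)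
qed

lemma gradient_has_derivative:
  assumes "C_k_on 2 u S" "z \<in> S"
  shows "\<exists>H. (gradient u has_derivative H) (at z) \<and> (\<Sum>b\<in>Basis. H b \<bullet> b) = laplacian u z"
proof -
  define H where "H h = (\<Sum>b\<in>Basis. frechet_derivative (partial_deriv b u) (at z) h *\<^sub>R b)" for h
  have "(partial_deriv b u has_derivative frechet_derivative (partial_deriv b u) (at z)) (at z)" if "b \<in> Basis" for b
    using assms that by (auto simp: numeral_2_eq_2 frechet_derivative_works)
  then have "(gradient u has_derivative H) (at z)"
    unfolding gradient_def[abs_def] H_def by (intro has_derivative_sum has_derivative_scaleR_left)
  moreover have "(\<Sum>b\<in>Basis. H b \<bullet> b) = laplacian u z"
  proof -
    have "H b \<bullet> b = partial_deriv b (partial_deriv b u) z" if "b \<in> Basis" for b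
    proof -
      have "H b \<bullet> b = (\<Sum>c\<in>Basis. frechet_derivative (partial_deriv c u) (at z) b * (c \<bullet> b))"
        by (simp add: H_def inner_sum_left)
      also have "\<dots> = (\<Sum>c\<in>Basis. if c = b then frechet_derivative (partial_deriv b u) (at z) b else 0)"
        using that by (intro sum.cong) (auto simp: inner_Basis)
      finally show ?thesis using that by (simp add: partial_deriv_def)
    qed
    then show ?thesis by (simp add: laplacian_def)
  qed
  ultimately show ?thesis by blast
qed

text \<open>Subtract the linear function with the extended gradient \<open>g z\<close> at the boundary point \<open>z\<close>. The rest has
  small gradient inside the convex set near \<open>z\<close>, hence a small Lipschitz constant there. Shrinking
  towards an interior point \<open>s\<close> carries this Lipschitz bound over to the closure by continuity. Full
  differentiability matters because the Kelvin transform evaluates \<open>u\<close> along curves that are not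
  normal to the boundary.\<close>

lemma C1_on_closure_differentiable:
  fixes u :: "'a::euclidean_space \<Rightarrow> real"
  assumes u: "C1_on_closure u S" and S: "open S" "convex S" and z: "z \<in> closure S"
  shows "\<exists>g. (u has_derivative (\<lambda>h. g \<bullet> h)) (at z within closure S)"
proof -
  have diff: "u differentiable (at w)" if "w \<in> S" for w
    using u that by (auto simp: C1_on_closure_def)
  have contu: "continuous_on (closure S) u"
    using u by (auto simp: C1_on_closure_def)
  obtain gb where gb: "\<And>b. b \<in> Basis \<Longrightarrow> continuous_on (closure S) (gb b)"
      "\<And>b w. b \<in> Basis \<Longrightarrow> w \<in> S \<Longrightarrow> gb b w = partial_deriv b u w"
    using u unfolding C1_on_closure_def by metis
  define g where "g w = (\<Sum>b\<in>Basis. gb b w *\<^sub>R b)" for w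
  have contg: "continuous_on (closure S) g"
    unfolding g_def by (intro continuous_intros gb)
  have g: "g w = gradient u w" if "w \<in> S" for w
    using that by (simp add: g_def gradient_def gb)
  define f where "f w = u w - g z \<bullet> w" for w
  have contf: "continuous_on (closure S) f"
    unfolding f_def by (intro continuous_intros contu)
  obtain s where s: "s \<in> S" using z by fastforce
  have key: "\<exists>d>0. \<forall>w\<in>closure S. norm (w - z) < d \<longrightarrow> norm (f w - f z) \<le> e * norm (w - z)" if "e > 0" for e
  proof -
    obtain d where d: "d > 0" "\<And>w. w \<in> closure S \<Longrightarrow> dist w z < d \<Longrightarrow> dist (g w) (g z) < e"
      using contg z \<open>e > 0\<close> unfolding continuous_on_iff by meson
    have inner_bound: "norm (f w - f w') \<le> e * norm (w - w')" if "w \<in> S \<inter> ball z d" "w' \<in> S \<inter> ball z d" for w w'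
    proof (rule differentiable_bound[where S = "S \<inter> ball z d" and f' = "\<lambda>w h. (g w - g z) \<bullet> h"])
      show "convex (S \<inter> ball z d)" using S by (intro convex_Int) auto
      show "(f has_derivative (\<bullet>) (g w - g z)) (at w within S \<inter> ball z d)" if "w \<in> S \<inter> ball z d" for w
      proof -
        have "(u has_derivative (\<bullet>) (g w)) (at w)"
          using has_derivative_gradient[OF diff, of w] g that by simp
        then have "(f has_derivative (\<bullet>) (g w - g z)) (at w)"
          unfolding f_def[abs_def] by (auto intro!: derivative_eq_intros simp: fun_eq_iff inner_diff_left)
        then show ?thesis by (rule has_derivative_at_withinI)
      qed
      show "onorm ((\<bullet>) (g w - g z)) \<le> e" if "w \<in> S \<inter> ball z d" for w
      proof (rule onorm_le)
        fix h :: 'a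
        have "w \<in> closure S" "dist w z < d"
          using that closure_subset[of S] by (auto simp: dist_commute)
        then have "norm (g w - g z) \<le> e"
          using d(2)[of w] by (simp add: dist_norm)
        then have "norm (g w - g z) * norm h \<le> e * norm h" by (rule mult_right_mono) simp
        moreover have "norm ((g w - g z) \<bullet> h) \<le> norm (g w - g z) * norm h"
          using Cauchy_Schwarz_ineq2[of "g w - g z" h] by simp
        ultimately show "norm ((g w - g z) \<bullet> h) \<le> e * norm h" by simp
      qed
    qed (use that in auto)
    have "norm (f w - f z) \<le> e * norm (w - z)" if w: "w \<in> closure S" "norm (w - z) < d" for w
    proof -
      define sh where "sh v t = v - t *\<^sub>R (v - s)" for v :: 'a and t :: real
      have shS: "sh v t \<in> S" if "v \<in> closure S" "0 < t" "t \<le> 1" for v t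
        using mem_interior_closure_convex_shrink[of S s v t] S s that by (simp add: sh_def interior_open)
      have sh_lim: "((\<lambda>t. sh v t) \<longlongrightarrow> v) (at_right 0)" for v
      proof -
        have "((\<lambda>t. sh v t) \<longlongrightarrow> v - 0 *\<^sub>R (v - s)) (at_right 0)"
          unfolding sh_def by (intro tendsto_intros)
        then show ?thesis by simp
      qed
      have ev1: "\<forall>\<^sub>F t in at_right (0::real). 0 < t \<and> t \<le> 1"
        by (rule eventually_at_rightI[of 0 1]) auto
      have f_lim: "((\<lambda>t. f (sh v t)) \<longlongrightarrow> f v) (at_right 0)" if "v \<in> closure S" for v
      proof (rule continuous_on_tendsto_compose[OF contf sh_lim that])
        show "\<forall>\<^sub>F t in at_right 0. sh v t \<in> closure S"
          using ev1 by eventually_elim (use shS that closure_subset in blast)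
      qed
      have evball: "\<forall>\<^sub>F t in at_right 0. sh v t \<in> ball z d" if "norm (v - z) < d" for v
        using topological_tendstoD[OF sh_lim, of "ball z d" v] that by (simp add: dist_norm norm_minus_commute)
      show ?thesis
      proof (rule tendsto_le)
        show "((\<lambda>t. e * norm (sh w t - sh z t)) \<longlongrightarrow> e * norm (w - z)) (at_right 0)"
          by (intro tendsto_intros sh_lim)
        show "((\<lambda>t. norm (f (sh w t) - f (sh z t))) \<longlongrightarrow> norm (f w - f z)) (at_right 0)"
          by (intro tendsto_intros f_lim w z)
        show "\<forall>\<^sub>F t in at_right 0. norm (f (sh w t) - f (sh z t)) \<le> e * norm (sh w t - sh z t)"
          using ev1 evball[OF w(2)] evball[of z, simplified, OF d(1)]
        proof eventually_elim
          case (elim t)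
          then show ?case using w z shS by (intro inner_bound) auto
        qed
      qed simp
    qed
    then show ?thesis using d(1) by blast
  qed
  have "(u has_derivative (\<lambda>h. g z \<bullet> h)) (at z within closure S)"
    unfolding has_derivative_within_alt
  proof (intro conjI allI impI)
    show "bounded_linear ((\<bullet>) (g z))" by (rule bounded_linear_inner_right)
    fix e :: real assume "0 < e"
    from key[OF this] show "\<exists>d>0. \<forall>y\<in>closure S. norm (y - z) < d \<longrightarrow> norm (u y - u z - g z \<bullet> (y - z)) \<le> e * norm (y - z)"
      by (simp add: f_def algebra_simps inner_diff_right)
  qed
  then show ?thesis by blast
qed

section \<open>Normal derivatives\<close>

lemma has_normal_derivative_lincomb:
  assumes "has_normal_derivative f d \<nu> z" "has_normal_derivative g e \<nu> z"
  shows "has_normal_derivative (\<lambda>x. \<alpha> * f x + \<beta> * g x) (\<alpha> * d + \<beta> * e) \<nu> z"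
  using assms unfolding has_normal_derivative_def by (auto intro!: derivative_eq_intros)

lemma has_normal_derivative_bottom_min:
  fixes f :: "'a::euclidean_space \<times> real \<Rightarrow> real"
  assumes "has_normal_derivative f d (0, -1) (x, 0)"
    and "\<forall>\<^sub>F t in at_right 0. f (x, 0) \<le> f (x, t)"
  shows "d \<le> 0"
proof -
  have lim: "((\<lambda>t. (f (x, - t) - f (x, 0)) / t) \<longlongrightarrow> d) (at_left 0)"
    using assms(1) unfolding has_normal_derivative_def has_field_derivative_iff by simp
  have "\<forall>\<^sub>F t in at_left 0. f (x, 0) \<le> f (x, - t)"
    using assms(2) by (subst at_left_minus) (simp add: eventually_filtermap)
  moreover have "\<forall>\<^sub>F t in at_left (0::real). t < 0"
    by (simp add: eventually_at_filter)
  ultimately have "\<forall>\<^sub>F t in at_left 0. (f (x, - t) - f (x, 0)) / t \<le> 0"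
    by eventually_elim (auto intro: divide_nonneg_neg)
  then show ?thesis using tendsto_upperbound[OF lim] by simp
qed

lemma has_normal_derivative_exp_quadratic:
  fixes z v c \<nu> :: "'a::euclidean_space"
  shows "has_normal_derivative (\<lambda>x. exp (\<alpha> + v \<bullet> x + \<sigma> * ((x - c) \<bullet> (x - c))))
    (((v + (2 * \<sigma>) *\<^sub>R (z - c)) \<bullet> \<nu>) * exp (\<alpha> + v \<bullet> z + \<sigma> * ((z - c) \<bullet> (z - c)))) \<nu> z"
proof -
  define w where "w = z - c"
  define g where "g = v + (2 * \<sigma>) *\<^sub>R w"
  define Q where "Q = \<alpha> + v \<bullet> z + \<sigma> * (w \<bullet> w)"
  have line: "\<alpha> + v \<bullet> (z + t *\<^sub>R \<nu>) + \<sigma> * ((z + t *\<^sub>R \<nu> - c) \<bullet> (z + t *\<^sub>R \<nu> - c))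
      = Q + t * (g \<bullet> \<nu>) + \<sigma> * (\<nu> \<bullet> \<nu>) * t\<^sup>2" for t
  proof -
    have w: "z + t *\<^sub>R \<nu> - c = w + t *\<^sub>R \<nu>" by (simp add: w_def)
    have sq: "(w + t *\<^sub>R \<nu>) \<bullet> (w + t *\<^sub>R \<nu>) = w \<bullet> w + 2 * t * (w \<bullet> \<nu>) + (\<nu> \<bullet> \<nu>) * t\<^sup>2"
      by (simp add: inner_simps inner_commute[of \<nu> w] power2_eq_square algebra_simps)
    have "g \<bullet> \<nu> = v \<bullet> \<nu> + 2 * \<sigma> * (w \<bullet> \<nu>)"
      by (simp add: g_def inner_add_left)
    then show ?thesis
      unfolding w sq by (simp add: Q_def inner_add_right algebra_simps)
  qed
  have "((\<lambda>t. exp (Q + t * (g \<bullet> \<nu>) + \<sigma> * (\<nu> \<bullet> \<nu>) * t\<^sup>2)) has_real_derivative ((g \<bullet> \<nu>) * exp Q)) (at_left 0)"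
    by (auto intro!: derivative_eq_intros)
  then show ?thesis
    unfolding has_normal_derivative_def line by (simp add: g_def Q_def w_def)
qed

lemma has_normal_derivative_const: "has_normal_derivative (\<lambda>x. c) 0 \<nu> z"
  unfolding has_normal_derivative_def by simp

lemma has_normal_derivative_unique:
  assumes "has_normal_derivative f d \<nu> z" "has_normal_derivative f e \<nu> z"
  shows "d = e"
  using assms unfolding has_normal_derivative_def has_field_derivative_iff
  by (rule tendsto_unique[rotated]) simp

lemma has_normal_derivative_of_has_derivative:
  assumes "(f has_derivative f') (at z within S)" "\<forall>\<^sub>F t in at_left 0. z + t *\<^sub>R \<nu> \<in> S"
  shows "has_normal_derivative f (f' \<nu>) \<nu> z"
proof -
  obtain e where e: "e < 0" "\<And>t. e < t \<Longrightarrow> t < 0 \<Longrightarrow> z + t *\<^sub>R \<nu> \<in> S"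
    using assms(2) unfolding eventually_at_left_field by auto
  have J: "at_left 0 = at 0 within {e<..<0}"
    using e(1) by (intro at_within_nhd[of _ "{e<..}"]) auto
  have lin: "linear f'" using assms(1) by (rule has_derivative_linear)
  have "((\<lambda>t. f (z + t *\<^sub>R \<nu>)) has_derivative (\<lambda>t. f' (t *\<^sub>R \<nu>))) (at 0 within {e<..<0})"
  proof (rule has_derivative_in_compose[where f = "\<lambda>t. z + t *\<^sub>R \<nu>" and f' = "\<lambda>t. t *\<^sub>R \<nu>" and g = f and g' = f'])
    show "((\<lambda>t. z + t *\<^sub>R \<nu>) has_derivative (\<lambda>t. t *\<^sub>R \<nu>)) (at 0 within {e<..<0})"
      by (auto intro!: derivative_eq_intros)
    show "(f has_derivative f') (at (z + 0 *\<^sub>R \<nu>) within (\<lambda>t. z + t *\<^sub>R \<nu>) ` {e<..<0})"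
    proof -
      have "(\<lambda>t. z + t *\<^sub>R \<nu>) ` {e<..<0} \<subseteq> S" using e(2) by auto
      with assms(1) show ?thesis by (simp add: has_derivative_subset)
    qed
  qed
  moreover have "(\<lambda>t. f' (t *\<^sub>R \<nu>)) = (*) (f' \<nu>)"
    by (simp add: fun_eq_iff linear_scale[OF lin])
  ultimately show ?thesis
    unfolding has_normal_derivative_def J has_field_derivative_def by simp
qed

text \<open>The inversion maps the normal line at a bottom point to a curve that leaves the image point in the
  normal direction, with speed \<open>l\<^sup>2 / r\<^sup>2\<close>; the conformal factor is stationary there. Since the
  centre lies on the hyperplane \<open>y = 0\<close>, the bottom is mapped into itself. The hypothesis \<open>r < l\<close> keeps
  the curve inside the closed quarter space for small parameters.\<close>

lemma has_normal_derivative_kelvin: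
  fixes f :: "(real ^ 'n::finite) \<times> real \<Rightarrow> real"
  assumes c: "c $ k < 0" and x: "0 \<le> x $ k" and l: "norm (x - c) < l"
    and f: "(f has_derivative (\<lambda>h. g \<bullet> h)) (at (c + (l\<^sup>2 / (norm (x - c))\<^sup>2) *\<^sub>R (x - c), 0) within closed_quarter k)"
  shows "has_normal_derivative (kelvin (c, 0) l f) ((l / norm (x - c)) ^ (CARD('n) + 1) * (- (g \<bullet> (0, 1)))) (0, -1) (x, 0)"
proof -
  define r where "r = norm (x - c)"
  have "x \<noteq> c" using c x by auto
  then have r: "r > 0" "r < l" using l by (auto simp: r_def)
  define \<rho> where "\<rho> t = r\<^sup>2 + t\<^sup>2" for t :: real
  have \<rho>: "\<rho> t > 0" for t using r by (simp add: \<rho>_def add_pos_nonneg)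
  define \<gamma> where "\<gamma> t = (c + (l\<^sup>2 / \<rho> t) *\<^sub>R (x - c), (l\<^sup>2 / \<rho> t) * (- t))" for t
  define A where "A t = (l / sqrt (\<rho> t)) ^ (CARD('n) - 1)" for t
  have kel: "kelvin (c, 0) l f ((x, 0) + t *\<^sub>R (0, -1)) = A t * f (\<gamma> t)" for t
  proof -
    have e: "(x, 0) + t *\<^sub>R (0, -1) - (c, 0::real) = (x - c, - t)" by simp
    have n2: "(norm (x - c, - t))\<^sup>2 = \<rho> t"
      by (simp add: norm_Pair \<rho>_def r_def)
    then have n: "norm (x - c, - t) = sqrt (\<rho> t)" by (simp add: norm_Pair \<rho>_def r_def)
    show ?thesis unfolding kelvin_def e n2 n using \<rho>[of t] by (simp add: A_def \<gamma>_def)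
  qed
  have d\<rho>: "((\<lambda>t. l\<^sup>2 / \<rho> t) has_real_derivative 0) (at 0)"
    unfolding \<rho>_def using r by (auto intro!: derivative_eq_intros)
  have dA: "(A has_real_derivative 0) (at 0)"
    unfolding A_def[abs_def] \<rho>_def using r by (auto intro!: derivative_eq_intros)
  have d\<gamma>: "(\<gamma> has_derivative (\<lambda>t. t *\<^sub>R (0, - (l\<^sup>2 / r\<^sup>2)))) (at 0)"
  proof -
    have d1: "((\<lambda>t. c + (l\<^sup>2 / \<rho> t) *\<^sub>R (x - c)) has_vector_derivative 0) (at 0)"
      using has_vector_derivative_add[OF has_vector_derivative_const[of c]
          has_vector_derivative_scaleR[OF d\<rho> has_vector_derivative_const[of "x - c"]]] by simp
    have d2: "((\<lambda>t. (l\<^sup>2 / \<rho> t) * (- t)) has_real_derivative - (l\<^sup>2 / r\<^sup>2)) (at 0)"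
      using DERIV_mult[OF d\<rho> DERIV_minus[OF DERIV_ident]] by (simp add: \<rho>_def)
    show ?thesis
      using has_vector_derivative_Pair[OF d1 d2[unfolded has_real_derivative_iff_has_vector_derivative]]
      by (simp add: \<gamma>_def[abs_def] has_vector_derivative_def)
  qed
  \<comment> \<open>For \<open>\<bar>t\<bar> < e\<close> the point stays inside the sphere, so inversion increases the \<open>k\<close>-th coordinate.\<close>
  define e where "e = sqrt (l\<^sup>2 - r\<^sup>2)"
  have e: "e > 0" "e\<^sup>2 = l\<^sup>2 - r\<^sup>2" using r by (auto simp: e_def power_strict_mono)
  define J where "J = {-e<..<0}"
  have J: "at_left 0 = at 0 within J"
    unfolding J_def using e(1) by (intro at_within_nhd[of _ "{-e<..<e}"]) auto
  have image: "\<gamma> ` J \<subseteq> closed_quarter k"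
  proof -
    have "\<gamma> t \<in> closed_quarter k" if t: "-e < t" "t < 0" for t
    proof -
      have "t\<^sup>2 < e\<^sup>2" using power2_strict_mono[of t e] t e by auto
      then have "1 \<le> l\<^sup>2 / \<rho> t" using \<rho>[of t] e by (simp add: \<rho>_def)
      then have "x $ k - c $ k \<le> l\<^sup>2 / \<rho> t * (x $ k - c $ k)"
        using c x mult_right_mono[of 1 "l\<^sup>2 / \<rho> t" "x $ k - c $ k"] by simp
      then show ?thesis using x t \<rho>[of t]
        by (auto simp: \<gamma>_def closed_quarter_def intro!: divide_nonpos_pos mult_nonneg_nonpos)
    qed
    then show ?thesis by (auto simp: J_def)
  qed
  have f\<gamma>: "((\<lambda>t. f (\<gamma> t)) has_derivative (\<lambda>t. g \<bullet> (t *\<^sub>R (0, - (l\<^sup>2 / r\<^sup>2))))) (at 0 within J)"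
  proof (rule has_derivative_in_compose[OF has_derivative_at_withinI[OF d\<gamma>]])
    have "\<gamma> 0 = (c + (l\<^sup>2 / (norm (x - c))\<^sup>2) *\<^sub>R (x - c), 0)"
      by (simp add: \<gamma>_def \<rho>_def r_def)
    with f show "(f has_derivative (\<lambda>h. g \<bullet> h)) (at (\<gamma> 0) within \<gamma> ` J)"
      using has_derivative_subset[OF _ image] by simp
  qed
  have g: "g \<bullet> (t *\<^sub>R (0, - (l\<^sup>2 / r\<^sup>2))) = (l / r)\<^sup>2 * (- (g \<bullet> (0, 1))) * t" for t
    by (cases g) (simp add: power_divide)
  have "((\<lambda>t. f (\<gamma> t)) has_real_derivative (l / r)\<^sup>2 * (- (g \<bullet> (0, 1)))) (at 0 within J)"
    using f\<gamma> unfolding g has_field_derivative_def .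
  note product = DERIV_mult[OF DERIV_subset[OF dA subset_UNIV] this]
  have "((\<lambda>t. A t * f (\<gamma> t)) has_real_derivative
      (A 0 * ((l / r)\<^sup>2 * (- (g \<bullet> (0, 1)))))) (at 0 within J)"
    using product by (simp add: mult.commute)
  moreover have "A 0 * ((l / r)\<^sup>2 * (- (g \<bullet> (0, 1)))) = (l / r) ^ (CARD('n) + 1) * (- (g \<bullet> (0, 1)))"
  proof -
    have "CARD('n) + 1 = (CARD('n) - 1) + 2" using zero_less_card_finite[where 'a='n] by simp
    then have "(l / r) ^ (CARD('n) + 1) = (l / r) ^ (CARD('n) - 1) * (l / r)\<^sup>2" by (metis power_add)
    moreover have "A 0 = (l / r) ^ (CARD('n) - 1)" using r by (simp add: A_def \<rho>_def)
    ultimately show ?thesis by simp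
  qed
  ultimately show ?thesis
    unfolding has_normal_derivative_def kel J r_def by simp
qed

section \<open>Comparison at minima and in spherical shells\<close>

lemma interior_min_laplacian_nonneg:
  assumes "has_laplacian f L z" "open U" "z \<in> U" "z \<in> quarter_space k"
    and "\<And>x. x \<in> U \<Longrightarrow> x \<in> closed_quarter k \<Longrightarrow> f z \<le> f x"
  shows "0 \<le> L"
proof (rule has_laplacian_min[OF assms(1)])
  have "\<forall>\<^sub>F x in nhds z. x \<in> U \<inter> quarter_space k"
    using assms open_quarter_space by (intro eventually_nhds_in_open) auto
  then show "\<forall>\<^sub>F x in nhds z. f z \<le> f x"
    by eventually_elim (auto intro!: assms(5) simp: quarter_space_def closed_quarter_def)
qed

lemma bottom_min_normal_derivative_nonpos:
  assumes "has_normal_derivative f d (0, -1) (x, 0)" "open U" "(x, 0) \<in> U" "0 \<le> x $ k"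
    and "\<And>z. z \<in> U \<Longrightarrow> z \<in> closed_quarter k \<Longrightarrow> f (x, 0) \<le> f z"
  shows "d \<le> 0"
proof (rule has_normal_derivative_bottom_min[OF assms(1)])
  have "((\<lambda>t::real. (x, t)) \<longlongrightarrow> (x, 0)) (at_right 0)"
    by (intro tendsto_intros)
  then have "\<forall>\<^sub>F t in at_right 0. (x, t) \<in> U"
    using assms topological_tendstoD by blast
  moreover have "\<forall>\<^sub>F t in at_right (0::real). 0 < t" by (simp add: eventually_at_filter)
  ultimately show "\<forall>\<^sub>F t in at_right 0. f (x, 0) \<le> f (x, t)"
    by eventually_elim (use assms in \<open>auto intro!: assms(5) simp: closed_quarter_def\<close>)
qed

text \<open>This combines the strong maximum principle and the Hopf lemma. The Gaussian \<open>g\<close> about \<open>Z\<close> is strictly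
  subharmonic outside radius \<open>r\<close> for \<open>A = N / r\<^sup>2\<close>. As \<open>Z\<close> lies above the bottom, \<open>g\<close> increases
  strictly with height at the bottom, which makes the comparison strict there too. A small multiple
  of \<open>g - E\<close>, which vanishes on the outer sphere, therefore lies below \<open>w\<close> as soon as \<open>w\<close> is
  positive on the compact set \<open>I\<close> made up of the inner sphere and the Dirichlet face.\<close>

lemma positive_on_shell:
  fixes w :: "(real ^ 'n::finite) \<times> real \<Rightarrow> real" and Z :: "(real ^ 'n) \<times> real"
    and r T :: real and k :: 'n
  defines "D \<equiv> {X \<in> closed_quarter k. r \<le> dist X Z \<and> dist X Z \<le> T}"
  assumes r: "0 < r" and Z: "0 < snd Z"
    and cont: "continuous_on D w" and nonneg: "\<And>X. X \<in> D \<Longrightarrow> 0 \<le> w X"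
    and lap: "\<And>X. X \<in> quarter_space k \<Longrightarrow> X \<in> D \<Longrightarrow> r < dist X Z \<Longrightarrow> dist X Z < T \<Longrightarrow> has_laplacian w 0 X"
    and bottom: "\<And>x. 0 < x $ k \<Longrightarrow> (x, 0) \<in> D \<Longrightarrow> r < dist (x, 0) Z \<Longrightarrow> dist (x, 0) Z < T \<Longrightarrow>
       \<exists>d\<ge>0. has_normal_derivative w d (0, -1) (x, 0)"
    and inner: "\<And>X. X \<in> D \<Longrightarrow> dist X Z = r \<or> fst X $ k = 0 \<Longrightarrow> 0 < w X"
    and X: "X \<in> D" "dist X Z < T"
  shows "0 < w X"
proof -
  define N where "N = real DIM((real ^ 'n) \<times> real)"
  have N: "N > 0" by (simp add: N_def)
  define A where "A = N / r\<^sup>2"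
  have A: "A > 0" using N r by (simp add: A_def)
  define g where "g X = exp (0 + 0 \<bullet> X + (- A) * ((X - Z) \<bullet> (X - Z)))" for X
  have g: "g X = exp (- A * (dist X Z)\<^sup>2)" for X
    by (simp add: g_def dist_norm power2_norm_eq_inner)
  define E where "E = exp (- A * T\<^sup>2)"
  have T: "0 < T" using X r by (auto simp: D_def)
  have g_gt: "E < g X" if "dist X Z < T" for X
    using that A T by (simp add: g E_def power_strict_mono)
  have compD: "compact D"
  proof -
    have "D = closed_quarter k \<inter> cball Z T \<inter> {X. r \<le> dist X Z}"
      by (auto simp: D_def dist_commute)
    moreover have "closed {X. r \<le> dist X Z}" by (intro closed_Collect_le continuous_intros)
    ultimately show ?thesis
      by (simp add: compact_Int_closed closed_Int_compact closed_closed_quarter)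
  qed
  define I where "I = {X \<in> D. dist X Z = r \<or> fst X $ k = 0}"
  have "compact I"
  proof -
    have "I = D \<inter> ({X. dist X Z = r} \<union> {X. fst X $ k = 0})" by (auto simp: I_def)
    moreover have "closed ({X. dist X Z = r} \<union> {X. fst X $ k = 0})"
      by (intro closed_Un closed_Collect_eq continuous_intros)
    ultimately show ?thesis using compD by (simp add: compact_Int_closed)
  qed
  obtain \<epsilon> where \<epsilon>: "\<epsilon> > 0" "\<And>X. X \<in> I \<Longrightarrow> \<epsilon> \<le> w X"
  proof (cases "I = {}")
    case False
    have "continuous_on I w" using cont by (rule continuous_on_subset) (auto simp: I_def)
    from continuous_attains_inf[OF \<open>compact I\<close> False this]
    obtain X1 where X1: "X1 \<in> I" "\<And>X. X \<in> I \<Longrightarrow> w X1 \<le> w X" by blast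
    have "0 < w X1" using X1(1) inner unfolding I_def by blast
    then show ?thesis using X1(2) by (rule that)
  qed (use that[of 1] in auto)
  define v where "v X = 1 * w X + (- \<epsilon>) * (1 * g X + (- E) * 1)" for X
  have contv: "continuous_on D v" unfolding v_def g_def by (intro continuous_intros cont)
  obtain X0 where X0: "X0 \<in> D" "\<And>X. X \<in> D \<Longrightarrow> v X0 \<le> v X"
    using continuous_attains_inf[OF compD _ contv] X by blast
  have "0 \<le> v X0"
  proof (rule ccontr)
    assume neg: "\<not> 0 \<le> v X0"
    have "E < g X0" using neg nonneg[OF X0(1)] \<epsilon>(1)
      by (simp add: v_def not_le) (smt (verit) mult_nonneg_nonpos)
    then have lt: "dist X0 Z < T"
      using A T by (simp add: g E_def) (smt (verit) power_mono)
    have "g X0 - E < 1" using A by (simp add: g E_def) (smt (verit) exp_gt_zero mult_nonneg_nonneg one_less_exp_iff zero_le_power2 exp_le_one_iff)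
    then have "\<epsilon> * (g X0 - E) < \<epsilon>" using \<epsilon>(1) by simp
    then have "X0 \<notin> I" using \<epsilon>(2)[of X0] neg by (auto simp: v_def algebra_simps)
    then have gt: "r < dist X0 Z" and k: "0 < fst X0 $ k"
      using X0(1) by (auto simp: I_def D_def closed_quarter_def less_le)
    define U where "U = {X. r < dist X Z \<and> dist X Z < T}"
    have U: "open U" unfolding U_def by (intro open_Collect_conj open_Collect_less continuous_intros)
    have X0U: "X0 \<in> U" using lt gt by (simp add: U_def)
    have min: "v X0 \<le> v X" if "X \<in> U" "X \<in> closed_quarter k" for X
      using that by (intro X0) (auto simp: U_def D_def)
    show False
    proof (cases "0 < snd X0")
      case True
      then have Q: "X0 \<in> quarter_space k" using k by (cases X0) (auto simp: quarter_space_def)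
      let ?L = "((norm (0 + (2 * (- A)) *\<^sub>R (X0 - Z)))\<^sup>2 + 2 * (- A) * N) * g X0"
      have "has_laplacian v (1 * 0 + (- \<epsilon>) * (1 * ?L + (- E) * 0)) X0"
        unfolding v_def g_def N_def
        by (intro has_laplacian_lincomb has_laplacian_const has_laplacian_exp_quadratic lap Q X0 gt lt)
      from interior_min_laplacian_nonneg[OF this U X0U Q min]
      have "?L \<le> 0" using \<epsilon>(1) by (simp add: mult_le_0_iff)
      moreover have "(norm (0 + (2 * (- A)) *\<^sub>R (X0 - Z)))\<^sup>2 = 4 * A\<^sup>2 * (dist X0 Z)\<^sup>2"
        by (simp add: power_mult_distrib dist_norm)
      moreover have "A * r\<^sup>2 < A * (dist X0 Z)\<^sup>2" using A gt r by (simp add: power_strict_mono)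
      then have "N < A * (dist X0 Z)\<^sup>2" using r by (simp add: A_def)
      then have "A * N < A * (A * (dist X0 Z)\<^sup>2)" using A by simp
      then have "0 < 4 * A\<^sup>2 * (dist X0 Z)\<^sup>2 + 2 * (- A) * N"
        using A N by (simp add: power2_eq_square mult.assoc)
      moreover have "0 < g X0" by (simp add: g_def)
      ultimately show False by (metis mult_pos_pos not_le)
    next
      case False
      then obtain x where x: "X0 = (x, 0)" using X0(1) by (cases X0) (auto simp: D_def closed_quarter_def)
      obtain d where d: "d \<ge> 0" "has_normal_derivative w d (0, -1) (x, 0)"
        using bottom[of x] k x X0(1) gt lt by auto
      let ?e = "((0 + (2 * (- A)) *\<^sub>R ((x, 0) - Z)) \<bullet> (0, -1)) * g (x, 0)"
      have "has_normal_derivative v (1 * d + (- \<epsilon>) * (1 * ?e + (- E) * 0)) (0, -1) (x, 0)"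
        unfolding v_def g_def
        by (intro has_normal_derivative_lincomb has_normal_derivative_const
            has_normal_derivative_exp_quadratic d)
      from bottom_min_normal_derivative_nonpos[OF this U, of k]
      have "1 * d + (- \<epsilon>) * (1 * ?e + (- E) * 0) \<le> 0"
        using X0U k min unfolding x by fastforce
      moreover
      have inn: "((x, 0) - Z) \<bullet> (0, -1) = snd Z"
        by (cases Z) simp
      then have "?e = - (2 * A * snd Z * g (x, 0))"
        by (simp only: add_0_left inner_scaleR_left inn)
      ultimately have "d + \<epsilon> * (2 * A * snd Z * g (x, 0)) \<le> 0" by (simp only:) simp
      moreover have "0 < \<epsilon> * (2 * A * snd Z * g (x, 0))"
        using \<epsilon>(1) A Z by (simp add: g_def)
      ultimately show False using d(1) by simp
    qed
  qed
  then have "\<epsilon> * (g X - E) \<le> w X" using X0(2)[OF X(1)] by (simp add: v_def algebra_simps)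
  moreover have "0 < \<epsilon> * (g X - E)" using \<epsilon>(1) g_gt[OF X(2)] by simp
  ultimately show ?thesis by simp
qed

section \<open>Solutions in the quarter space\<close>

locale quarter_space_solution =
  fixes k :: "'n::finite" and p :: real and u :: "(real ^ 'n) \<times> real \<Rightarrow> real"
  assumes solution: "classical_solution k p u" and p_ge_1: "1 \<le> p"
    and critical: "CARD('n) \<ge> 2 \<Longrightarrow> p \<le> (real CARD('n) + 1) / (real CARD('n) - 1)"
begin

lemma C2: "C_k_on 2 u (quarter_space k)"
  and C1: "C1_on_closure u (quarter_space k)"
  and laplacian_eq_0: "z \<in> quarter_space k \<Longrightarrow> laplacian u z = 0"
  and positive: "z \<in> quarter_space k \<Longrightarrow> 0 < u z"
  and dirichlet: "x $ k = 0 \<Longrightarrow> 0 \<le> y \<Longrightarrow> u (x, y) = 0"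
  and neumann: "0 < x $ k \<Longrightarrow> has_normal_derivative u (u (x, 0) powr p) (0, -1) (x, 0)"
  using solution by (auto simp: classical_solution_def)

lemma continuous: "continuous_on (closed_quarter k) u"
  using C1 by (auto simp: C1_on_closure_def closure_quarter_space)

lemma nonneg:
  assumes "z \<in> closed_quarter k"
  shows "0 \<le> u z"
proof (rule continuous_ge_on_closure[where S = "quarter_space k"])
  show "continuous_on (closure (quarter_space k)) u" using continuous by (simp add: closure_quarter_space)
qed (use assms positive in \<open>auto simp: closure_quarter_space intro: less_imp_le\<close>)

lemma has_derivative_near:
  assumes "z \<in> quarter_space k"
  shows "\<forall>\<^sub>F y in nhds z. (u has_derivative (\<lambda>h. gradient u y \<bullet> h)) (at y)"
proof -
  have "\<forall>\<^sub>F y in nhds z. y \<in> quarter_space k"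
    using assms open_quarter_space by (intro eventually_nhds_in_open) auto
  then show ?thesis
  proof eventually_elim
    case (elim y)
    then have "u differentiable (at y)" using C1 by (auto simp: C1_on_closure_def)
    then show ?case by (rule has_derivative_gradient)
  qed
qed

lemma has_laplacian_0:
  assumes "z \<in> quarter_space k"
  shows "has_laplacian u 0 z"
proof -
  obtain H where "(gradient u has_derivative H) (at z)" "(\<Sum>b\<in>Basis. H b \<bullet> b) = laplacian u z"
    using gradient_has_derivative[OF C2 assms] by blast
  then show ?thesis
    using has_laplacian_of_hessian[OF has_derivative_near[OF assms]] laplacian_eq_0[OF assms] by fastforce
qed

lemma kelvin_harmonic:
  assumes "0 < l" "X \<noteq> C" "C + (l\<^sup>2 / (norm (X - C))\<^sup>2) *\<^sub>R (X - C) \<in> quarter_space k" (is "?Z \<in> _")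
  shows "has_laplacian (kelvin C l u) 0 X"
proof -
  obtain H where "(gradient u has_derivative H) (at ?Z)" "(\<Sum>b\<in>Basis. H b \<bullet> b) = laplacian u ?Z"
    using gradient_has_derivative[OF C2 assms(3)] by blast
  then show ?thesis
    using assms laplacian_eq_0[OF assms(3)] zero_less_card_finite[where 'a='n]
    by (intro has_laplacian_kelvin[OF _ _ _ refl has_derivative_near]) auto
qed

lemma has_derivative_bottom:
  assumes "0 < x $ k"
  obtains g where "(u has_derivative (\<lambda>h. g \<bullet> h)) (at (x, 0) within closed_quarter k)"
    and "- (g \<bullet> (0, 1)) = u (x, 0) powr p"
proof -
  have "(x, 0) \<in> closure (quarter_space k)"
    using assms by (simp add: closure_quarter_space closed_quarter_def)
  then obtain g where g: "(u has_derivative (\<lambda>h. g \<bullet> h)) (at (x, 0) within closed_quarter k)"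
    using C1_on_closure_differentiable[OF C1 open_quarter_space convex_quarter_space]
    unfolding closure_quarter_space by blast
  have "\<forall>\<^sub>F t in at_left (0::real). t < 0" by (simp add: eventually_at_filter)
  then have "\<forall>\<^sub>F t in at_left 0. (x, 0) + t *\<^sub>R (0, - 1) \<in> closed_quarter k"
    by eventually_elim (use assms in \<open>simp add: closed_quarter_def\<close>)
  from has_normal_derivative_unique[OF has_normal_derivative_of_has_derivative[OF g this] neumann[OF assms]]
  have "- (g \<bullet> (0, 1)) = u (x, 0) powr p" by (cases g) simp
  with g show ?thesis by (rule that)
qed

text \<open>A point with \<open>u = 0\<close> on the bottom would have normal derivative \<open>0\<close>, which the shell comparison
  excludes. The shell is centred above \<open>(x, 0)\<close> and reaches just below it, but not as far as the Dirichlet face.\<close>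

lemma positive_bottom:
  assumes "0 < x $ k"
  shows "0 < u (x, 0)"
proof -
  define h where "h = x $ k / 2"
  have h: "h > 0" using assms by (simp add: h_def)
  let ?Z = "(x, h)"
  have ins: "0 < fst X $ k \<and> \<bar>snd X - h\<bar> \<le> dist X ?Z" if "dist X ?Z \<le> 3 * h / 2" for X
  proof -
    have "dist (fst X) x \<le> dist X ?Z" using dist_fst_le[of X ?Z] by simp
    then have "\<bar>(fst X - x) $ k\<bar> \<le> 3 * h / 2"
      using that component_le_norm_cart[of "fst X - x" k] by (simp add: dist_norm)
    moreover have "dist (snd X) h \<le> dist X ?Z" using dist_snd_le[of X ?Z] by simp
    ultimately show ?thesis using h unfolding h_def dist_real_def vector_minus_component by linarith
  qed
  show ?thesis
  proof (rule positive_on_shell[where r = "h / 2" and T = "3 * h / 2" and k = k and Z = ?Z])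
    let ?D = "{X \<in> closed_quarter k. h / 2 \<le> dist X ?Z \<and> dist X ?Z \<le> 3 * h / 2}"
    show "continuous_on ?D u" using continuous by (rule continuous_on_subset) auto
    show "0 \<le> u X" if "X \<in> ?D" for X using that nonneg by auto
    show "\<exists>d\<ge>0. has_normal_derivative u d (0, - 1) (x', 0)" if "0 < x' $ k" for x'
      using neumann[OF that] powr_ge_zero by blast
    show "0 < u X" if "X \<in> ?D" "dist X ?Z = h / 2 \<or> fst X $ k = 0" for X
      using that ins[of X] h by (intro positive) (cases X, auto simp: quarter_space_def)
    show "(x, 0) \<in> ?D" "dist (x, 0) ?Z < 3 * h / 2"
      using h assms by (auto simp: closed_quarter_def dist_Pair_Pair dist_real_def)
  qed (use h has_laplacian_0 in auto)
qed

lemma positive_off_face: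
  assumes "X \<in> closed_quarter k" "0 < fst X $ k"
  shows "0 < u X"
proof (cases "snd X = 0")
  case True then show ?thesis using positive_bottom[of "fst X"] assms by (cases X) auto
next
  case False then show ?thesis using assms
    by (intro positive) (cases X, auto simp: quarter_space_def closed_quarter_def)
qed

end

section \<open>Moving spheres\<close>

text \<open>By the mean value theorem the nonlinearity is Lipschitz on \<open>[0, U]\<close>, including at \<open>0\<close> as \<open>p \<ge> 1\<close>.\<close>

lemma powr_diff_le:
  fixes p :: real
  assumes "1 \<le> p" "0 \<le> s" "s \<le> t" "t \<le> U" "0 < U"
  shows "t powr p - s powr p \<le> p * U powr (p - 1) * (t - s)"
proof (cases "s = t")
  case False
  then have st: "s < t" using assms by simp
  have "continuous_on {s..t} (\<lambda>x. x powr p)"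
    using assms by (intro continuous_on_powr' continuous_intros) auto
  moreover have "((\<lambda>x. x powr p) has_real_derivative p * x powr (p - 1)) (at x)" if "s < x" for x
    using that assms by (intro has_real_derivative_powr) auto
  ultimately obtain x where x: "s < x" "x < t" "t powr p - s powr p = (t - s) * (p * x powr (p - 1))"
    using MVT[OF st, of "\<lambda>x. x powr p"] by (metis DERIV_unique real_differentiable_def)
  have "x powr (p - 1) \<le> U powr (p - 1)" using x assms by (intro powr_mono2) auto
  then have "(t - s) * (p * x powr (p - 1)) \<le> (t - s) * (p * U powr (p - 1))"
    using st assms by (intro mult_left_mono) auto
  then show ?thesis using x by (simp add: mult_ac)
qed simp

text \<open>The centre lies outside the closed quarter space, so that spheres about it cut off compact caps on
  which the Kelvin transform is regular.\<close>

locale moving_sphere = quarter_space_solution +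
  fixes c :: "real ^ 'n"
  assumes centre: "c $ k < 0"
begin

definition cap :: "real \<Rightarrow> ((real ^ 'n) \<times> real) set" where
  "cap l = {X \<in> closed_quarter k. dist X (c, 0) \<le> l}"

definition inversion :: "real \<Rightarrow> (real ^ 'n) \<times> real \<Rightarrow> (real ^ 'n) \<times> real" where
  "inversion l X = (c, 0) + (l\<^sup>2 / (norm (X - (c, 0)))\<^sup>2) *\<^sub>R (X - (c, 0))"

definition excess :: "real \<Rightarrow> (real ^ 'n) \<times> real \<Rightarrow> real" where
  "excess l X = kelvin (c, 0) l u X - u X"

lemma kelvin_eq: "kelvin (c, 0) l u X = (l / dist X (c, 0)) ^ (CARD('n) - 1) * u (inversion l X)"
  by (simp add: kelvin_def inversion_def dist_norm)

lemma dist_centre: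
  assumes "X \<in> closed_quarter k"
  shows "fst X $ k - c $ k \<le> dist X (c, s)" "- c $ k \<le> dist X (c, s)" "0 < dist X (c, s)"
proof -
  have "fst X $ k - c $ k \<le> norm (fst X - c)"
    using component_le_norm_cart[of "fst X - c" k] by simp
  also have "\<dots> \<le> dist X (c, s)" using dist_fst_le[of X "(c, s)"] by (simp add: dist_norm)
  finally show "fst X $ k - c $ k \<le> dist X (c, s)" .
  then show "- c $ k \<le> dist X (c, s)" "0 < dist X (c, s)"
    using assms centre by (auto simp: closed_quarter_def)
qed

lemma inversion_coords:
  "fst (inversion l X) $ k = c $ k + (l / dist X (c, 0))\<^sup>2 * (fst X $ k - c $ k)"
  "snd (inversion l X) = (l / dist X (c, 0))\<^sup>2 * snd X"
  by (simp_all add: inversion_def dist_norm power_divide)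

text \<open>Inside the sphere the inversion moves points away from the centre, and with \<open>c\<^sub>k < 0\<close> this increases
  the \<open>k\<close>-th coordinate. So the transform in a cap uses \<open>u\<close> in its domain only.\<close>

lemma inversion_mem:
  assumes "X \<in> cap l"
  shows "inversion l X \<in> closed_quarter k" "fst X $ k \<le> fst (inversion l X) $ k"
    and "X \<in> quarter_space k \<Longrightarrow> inversion l X \<in> quarter_space k"
    and "dist X (c, 0) < l \<Longrightarrow> 0 < fst (inversion l X) $ k"
proof -
  let ?s = "(l / dist X (c, 0))\<^sup>2"
  have X: "X \<in> closed_quarter k" "dist X (c, 0) \<le> l" using assms by (auto simp: cap_def)
  have q: "1 \<le> l / dist X (c, 0)" using X dist_centre(3)[OF X(1), of 0] by simp
  then have s: "1 \<le> ?s" by (rule one_le_power)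
  have k: "0 \<le> fst X $ k" "0 \<le> snd X" using X by (auto simp: closed_quarter_def)
  have "1 * (fst X $ k - c $ k) \<le> ?s * (fst X $ k - c $ k)"
    using s k centre by (intro mult_right_mono) auto
  then show le: "fst X $ k \<le> fst (inversion l X) $ k" by (simp add: inversion_coords)
  show "inversion l X \<in> closed_quarter k"
    using le k by (simp add: mem_closed_quarter inversion_coords)
  show "inversion l X \<in> quarter_space k" if "X \<in> quarter_space k"
  proof -
    have "0 < fst X $ k" "0 < snd X" using that by (auto simp: mem_quarter_space)
    moreover have "0 < ?s" using s by linarith
    ultimately show ?thesis using le unfolding mem_quarter_space inversion_coords(2) by simp
  qed
  show "0 < fst (inversion l X) $ k" if "dist X (c, 0) < l"
  proof -
    have "1 < l / dist X (c, 0)" using that dist_centre(3)[OF X(1), of 0] by simp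
    then have "1 < ?s" by (simp add: one_less_power)
    then have "1 * (fst X $ k - c $ k) < ?s * (fst X $ k - c $ k)"
      using k centre by (intro mult_strict_right_mono) auto
    then show ?thesis using k by (simp add: inversion_coords)
  qed
qed

lemma compact_cap: "compact (cap l)"
proof -
  have "cap l = closed_quarter k \<inter> cball (c, 0) l" by (auto simp: cap_def dist_commute)
  then show ?thesis by (simp add: closed_Int_compact closed_closed_quarter)
qed

lemma closed_caps: "closed {(l, X). X \<in> cap l}"
proof -
  have "{(l, X). X \<in> cap l} = (UNIV \<times> closed_quarter k) \<inter> {Y. dist (snd Y) (c, 0) \<le> fst Y}"
    by (auto simp: cap_def)
  then show ?thesis
    by (simp only:) (intro closed_Int closed_Times closed_Collect_le continuous_intros closed_closed_quarter closed_UNIV)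
qed

lemma continuous_on_kelvin: "continuous_on {(l, X). X \<in> cap l} (\<lambda>Y. kelvin (c, 0) (fst Y) u (snd Y))"
proof -
  have nz: "dist (snd Y) (c, 0) \<noteq> 0" if "Y \<in> {(l, X). X \<in> cap l}" for Y
    using that dist_centre(3)[of "snd Y" 0] by (auto simp: cap_def)
  have "continuous_on {(l, X). X \<in> cap l} (\<lambda>Y. inversion (fst Y) (snd Y))"
    unfolding inversion_def using nz by (intro continuous_intros) (auto simp: dist_norm)
  then have "continuous_on {(l, X). X \<in> cap l} (\<lambda>Y. u (inversion (fst Y) (snd Y)))"
    by (rule continuous_on_compose2[OF continuous]) (auto intro: inversion_mem)
  then show ?thesis
    unfolding kelvin_eq using nz by (intro continuous_intros) auto
qed

lemma continuous_on_excess: "continuous_on {(l, X). X \<in> cap l} (\<lambda>Y. excess (fst Y) (snd Y))"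
proof -
  have "continuous_on {(l, X). X \<in> cap l} (\<lambda>Y. u (snd Y))"
    by (rule continuous_on_compose2[OF continuous]) (auto intro!: continuous_intros simp: cap_def)
  then show ?thesis unfolding excess_def by (intro continuous_intros continuous_on_kelvin)
qed

lemma continuous_on_excess_cap: "continuous_on (cap l) (excess l)"
proof -
  have "continuous_on (cap l) (\<lambda>X. (\<lambda>Y. excess (fst Y) (snd Y)) (l, X))"
    by (rule continuous_on_compose2[OF continuous_on_excess]) (auto intro!: continuous_intros)
  then show ?thesis by simp
qed

lemma kelvin_nonneg: "0 \<le> l \<Longrightarrow> X \<in> cap l \<Longrightarrow> 0 \<le> kelvin (c, 0) l u X"
  unfolding kelvin_eq using nonneg inversion_mem(1) by simp

lemma excess_sphere:
  assumes "X \<in> closed_quarter k" "dist X (c, 0) = l"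
  shows "excess l X = 0"
proof -
  have "0 < l" using dist_centre(3)[OF assms(1), of 0] assms(2) by metis
  then have "inversion l X = X" "l / dist X (c, 0) = 1"
    using assms(2) by (auto simp: inversion_def dist_norm)
  then show ?thesis by (simp only: excess_def kelvin_eq) simp
qed

lemma excess_face:
  assumes "X \<in> cap l" "dist X (c, 0) < l" "fst X $ k = 0"
  shows "0 < excess l X"
proof -
  have d: "0 < dist X (c, 0)" using assms dist_centre(3)[of X 0] by (simp add: cap_def)
  have "0 < u (inversion l X)" using assms by (intro positive_off_face inversion_mem) auto
  then have "0 < kelvin (c, 0) l u X"
    unfolding kelvin_eq using d less_trans[OF d assms(2)] by (intro mult_pos_pos zero_less_power divide_pos_pos)
  moreover have "u X = 0" using assms dirichlet[of "fst X" "snd X"] by (auto simp: cap_def closed_quarter_def)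
  ultimately show ?thesis by (simp add: excess_def)
qed

lemma excess_laplacian:
  assumes "X \<in> quarter_space k" "X \<in> cap l"
  shows "has_laplacian (excess l) 0 X"
proof -
  have d: "0 < dist X (c, 0)" using assms dist_centre(3)[of X 0] by (simp add: cap_def)
  have "has_laplacian (kelvin (c, 0) l u) 0 X"
  proof (rule kelvin_harmonic)
    have "dist X (c, 0) \<le> l" using assms(2) by (simp add: cap_def)
    with d show "0 < l" by linarith
    show "X \<noteq> (c, 0)" using d by auto
    show "(c, 0) + (l\<^sup>2 / (norm (X - (c, 0)))\<^sup>2) *\<^sub>R (X - (c, 0)) \<in> quarter_space k"
      using inversion_mem(3)[OF assms(2,1)] by (simp add: inversion_def)
  qed
  from has_laplacian_lincomb[OF this has_laplacian_0[OF assms(1)], of 1 "-1"]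
  show ?thesis by (simp add: excess_def[abs_def])
qed

text \<open>The conformal weights of the two sides of the boundary condition differ by the exponent
  \<open>(n + 1) - (n - 1) p\<close>, and \<open>l / r \<ge> 1\<close> in the cap. Here the bound on \<open>p\<close> is used.\<close>

lemma kelvin_neumann:
  assumes x: "0 \<le> x $ k" and l: "dist (x, 0) (c, 0::real) < l"
  obtains d where "kelvin (c, 0) l u (x, 0) powr p \<le> d"
    "has_normal_derivative (kelvin (c, 0) l u) d (0, -1) (x, 0)"
proof -
  let ?n = "CARD('n)" and ?r = "norm (x - c)"
  define z where "z = c + (l\<^sup>2 / ?r\<^sup>2) *\<^sub>R (x - c)"
  have X: "(x, 0) \<in> closed_quarter k" using x by (simp add: closed_quarter_def)
  have dr: "dist (x, 0) (c, 0) = ?r" by (simp add: dist_Pair_Pair dist_norm)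
  have cap: "(x, 0) \<in> cap l" using X less_imp_le[OF l] by (simp add: cap_def)
  have inv: "inversion l (x, 0) = (z, 0)" by (simp add: inversion_def z_def norm_Pair)
  have r: "0 < ?r" using dist_centre(3)[OF X, of 0] by (simp add: dr)
  have q: "1 \<le> l / ?r" using l r by (simp add: dr)
  have zk: "0 < z $ k" using inversion_mem(4)[OF cap l] by (simp add: inv)
  obtain g where g: "(u has_derivative (\<lambda>h. g \<bullet> h)) (at (z, 0) within closed_quarter k)"
    "- (g \<bullet> (0, 1)) = u (z, 0) powr p"
    using has_derivative_bottom[OF zk] .
  have "has_normal_derivative (kelvin (c, 0) l u) ((l / ?r) ^ (?n + 1) * (- (g \<bullet> (0, 1)))) (0, -1) (x, 0)"
    using centre x l g(1) by (intro has_normal_derivative_kelvin[where k = k]) (simp_all add: z_def dr)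
  moreover have "kelvin (c, 0) l u (x, 0) powr p \<le> (l / ?r) ^ (?n + 1) * (- (g \<bullet> (0, 1)))"
  proof -
    have "real (?n - 1) * p \<le> real (?n + 1)"
    proof (cases "?n \<ge> 2")
      case True
      then have "p * (real ?n - 1) \<le> real ?n + 1" using critical by (simp add: field_simps)
      then show ?thesis using True by (simp add: of_nat_diff mult.commute)
    next
      case False
      then have "?n = 1" using zero_less_card_finite[where 'a='n] by linarith
      then show ?thesis by simp
    qed
    then have "(l / ?r) powr (real (?n - 1) * p) \<le> (l / ?r) powr real (?n + 1)"
      using q by (intro powr_mono)
    also have "\<dots> = (l / ?r) ^ (?n + 1)" using q by (intro powr_realpow) simp
    finally have le: "(l / ?r) powr (real (?n - 1) * p) \<le> (l / ?r) ^ (?n + 1)" .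
    have "kelvin (c, 0) l u (x, 0) powr p = ((l / ?r) ^ (?n - 1)) powr p * u (z, 0) powr p"
      unfolding kelvin_eq inv dr by (rule powr_mult)
    also have "((l / ?r) ^ (?n - 1)) powr p = (l / ?r) powr (real (?n - 1) * p)"
      using q by (subst powr_realpow[symmetric]) (auto simp: powr_powr)
    also have "(l / ?r) powr (real (?n - 1) * p) * u (z, 0) powr p \<le> (l / ?r) ^ (?n + 1) * u (z, 0) powr p"
      using le by (intro mult_right_mono) auto
    finally show ?thesis using g(2) by simp
  qed
  ultimately show ?thesis using that by blast
qed

text \<open>The shell is centred slightly above \<open>C\<close>, has inner radius \<open>- c\<^sub>k\<close> and an outer radius between \<open>r\<close> and
  \<open>l\<close>. Its inner sphere meets the closed quarter space on the Dirichlet face only, where \<open>excess l\<close> is positive.\<close>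

lemma excess_positive:
  assumes w: "\<And>X. X \<in> cap l \<Longrightarrow> 0 \<le> excess l X"
    and X: "X \<in> cap l" "0 < fst X $ k" "dist X (c, 0) < l"
  shows "0 < excess l X"
proof -
  define r where "r = dist X (c, 0)"
  define s where "s = (l - r) / 4"
  have s: "0 < s" "r + 3 * s < l" using X by (auto simp: s_def r_def field_simps)
  have triangle: "\<bar>dist Y (c, s) - dist Y (c, 0)\<bar> \<le> s" for Y
  proof -
    have "dist (c, s) (c, 0) = s" using s by (simp add: dist_Pair_Pair dist_real_def)
    then show ?thesis using dist_triangle[of Y "(c, s)" "(c, 0)"] dist_triangle[of Y "(c, 0)" "(c, s)"]
      by (simp add: dist_commute)
  qed
  let ?D = "{Y \<in> closed_quarter k. - c $ k \<le> dist Y (c, s) \<and> dist Y (c, s) \<le> r + 2 * s}"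
  have D: "Y \<in> cap l \<and> dist Y (c, 0) < l" if "Y \<in> ?D" for Y
    using that triangle[of Y] s by (auto simp: cap_def)
  show ?thesis
  proof (rule positive_on_shell[where Z = "(c, s)" and r = "- c $ k" and T = "r + 2 * s" and k = k])
    show "continuous_on ?D (excess l)"
      using continuous_on_excess_cap by (rule continuous_on_subset) (use D in blast)
    show "0 \<le> excess l Y" if "Y \<in> ?D" for Y using D[OF that] w by blast
    show "has_laplacian (excess l) 0 Y" if "Y \<in> quarter_space k" "Y \<in> ?D" for Y
      using D[OF that(2)] that(1) excess_laplacian by blast
    show "\<exists>d\<ge>0. has_normal_derivative (excess l) d (0, - 1) (x, 0)" if x: "0 < x $ k" "(x, 0) \<in> ?D" for x
    proof -
      obtain d where d: "kelvin (c, 0) l u (x, 0) powr p \<le> d"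
        "has_normal_derivative (kelvin (c, 0) l u) d (0, -1) (x, 0)"
        using kelvin_neumann[of x l] D[OF x(2)] x(1) by auto
      have "u (x, 0) \<le> kelvin (c, 0) l u (x, 0)"
        using D[OF x(2)] w[of "(x, 0)"] by (simp add: excess_def)
      then have "u (x, 0) powr p \<le> kelvin (c, 0) l u (x, 0) powr p"
        using p_ge_1 nonneg[of "(x, 0)"] x by (intro powr_mono2) auto
      then have "0 \<le> 1 * d + (-1) * u (x, 0) powr p" using d(1) by simp
      moreover have "has_normal_derivative (excess l) (1 * d + (-1) * u (x, 0) powr p) (0, -1) (x, 0)"
        using has_normal_derivative_lincomb[OF d(2) neumann[OF x(1)], of 1 "-1"]
        by (simp add: excess_def[abs_def])
      ultimately show ?thesis by blast
    qed
    show "0 < excess l Y" if Y: "Y \<in> ?D" "dist Y (c, s) = - c $ k \<or> fst Y $ k = 0" for Y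
    proof -
      have "fst Y $ k = 0"
        using Y dist_centre(1)[of Y s] by (auto simp: closed_quarter_def)
      then show ?thesis using D[OF Y(1)] excess_face by blast
    qed
    show "X \<in> ?D" "dist X (c, s) < r + 2 * s"
      using X triangle[of X] s dist_centre(2)[of X s] by (auto simp: cap_def r_def)
  qed (use s centre in auto)
qed

text \<open>Radius and point are treated as one variable, so that a minimal bad radius can be found by
  compactness.\<close>

lemma compact_caps: "compact ({(l, X). X \<in> cap l} \<inter> {Y. fst Y \<le> \<Lambda>})"
proof -
  have "closed ({(l, X). X \<in> cap l} \<inter> {Y. fst Y \<le> \<Lambda>})"
    by (intro closed_Int closed_caps closed_Collect_le continuous_intros)
  moreover have "{(l, X). X \<in> cap l} \<inter> {Y. fst Y \<le> \<Lambda>} \<subseteq> {0..\<Lambda>} \<times> cball (c, 0) \<Lambda>"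
  proof
    fix Y assume "Y \<in> {(l, X). X \<in> cap l} \<inter> {Y. fst Y \<le> \<Lambda>}"
    then have "dist (snd Y) (c, 0) \<le> fst Y" "fst Y \<le> \<Lambda>" by (auto simp: cap_def)
    moreover from this have "0 \<le> fst Y" by (meson order_trans zero_le_dist)
    ultimately show "Y \<in> {0..\<Lambda>} \<times> cball (c, 0) \<Lambda>" by (cases Y) (auto simp: dist_commute)
  qed
  ultimately show ?thesis
    using compact_Int_closed[OF compact_Times[OF compact_Icc compact_cball]]
    by (metis inf.absorb_iff2)
qed

text \<open>This is a narrow domain maximum principle. The comparison function \<open>\<psi>\<close> decays with rate \<open>M\<close> in \<open>y\<close>, so
  that on the bottom its normal derivative \<open>M \<psi>\<close> beats the Lipschitz constant \<open>M - 1\<close> of the nonlinearity.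
  This costs a term \<open>3 M\<^sup>2\<close> in the Laplacian, which is compensated within distance of order
  \<open>1 / B\<close> of the Dirichlet face by \<open>f2\<close> and near the sphere by \<open>f3\<close>. Hence a negative minimum of
  \<open>excess l / \<psi>\<close> cannot occur on the bottom, and in the interior it can occur only in the core of the cap, where
  \<open>x\<^sub>k\<close> and \<open>l\<^sup>2 - r\<^sup>2\<close> are at least \<open>1 / B\<close>. The constant \<open>B\<close> is the same for all radii up to \<open>\<Lambda>\<close>.\<close>

lemma negative_somewhere_in_core:
  obtains B where "0 < B"
    and "\<And>l X. l \<le> \<Lambda> \<Longrightarrow> X \<in> cap l \<Longrightarrow> excess l X < 0 \<Longrightarrow>
      \<exists>X\<in>cap l. excess l X < 0 \<and> 1 / B \<le> fst X $ k \<and> 1 / B \<le> l\<^sup>2 - (dist X (c, 0))\<^sup>2"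
proof -
  let ?S = "{(l, X). X \<in> cap l} \<inter> {Y. fst Y \<le> \<Lambda>}"
  have "bounded ((\<lambda>Y. u (snd Y)) ` ?S)"
  proof (intro compact_imp_bounded compact_continuous_image compact_caps)
    show "continuous_on ?S (\<lambda>Y. u (snd Y))"
      by (rule continuous_on_compose2[OF continuous]) (auto intro!: continuous_intros simp: cap_def)
  qed
  then obtain U where U: "U > 0" "\<And>Y. Y \<in> ?S \<Longrightarrow> \<bar>u (snd Y)\<bar> \<le> U"
    unfolding bounded_pos by auto
  define a where "a = - c $ k"
  have a: "a > 0" using centre by (simp add: a_def)
  define M where "M = p * U powr (p - 1) + 1"
  have M: "M \<ge> 1" using p_ge_1 by (simp add: M_def)
  \<comment> \<open>One constant serves both conditions: \<open>B > 3 M\<close> for the face, \<open>B a > 3 M\<close> for the sphere, as \<open>r \<ge> a\<close> in a cap.\<close>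
  define B where "B = 3 * M * (1 + 1 / a)"
  have B: "3 * M < B" "3 * M < B * a" using M a by (auto simp: B_def field_simps add_pos_pos)
  then have B0: "0 < B" using M by linarith
  have core: "\<exists>X\<in>cap l. excess l X < 0 \<and> 1 / B \<le> fst X $ k \<and> 1 / B \<le> l\<^sup>2 - (dist X (c, 0))\<^sup>2"
    if l: "l \<le> \<Lambda>" and ex: "X \<in> cap l" "excess l X < 0" for l X
  proof -
    define f1 where "f1 X = exp (0 + (0, - M) \<bullet> X + 0 * ((X - 0) \<bullet> (X - 0)))" for X :: "(real ^ 'n) \<times> real"
    define f2 where "f2 X = exp (0 + ((- B) *\<^sub>R axis k 1, - M) \<bullet> X + 0 * ((X - 0) \<bullet> (X - 0)))" for X :: "(real ^ 'n) \<times> real"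
    define f3 where "f3 X = exp (- B * l\<^sup>2 + (0, - M) \<bullet> X + B * ((X - (c, 0)) \<bullet> (X - (c, 0))))" for X :: "(real ^ 'n) \<times> real"
    have f1: "f1 X = exp (- M * snd X)" for X by (simp add: f1_def inner_prod_def)
    have f2: "f2 X = f1 X * exp (- B * fst X $ k)" for X
      unfolding f1 f2_def exp_add[symmetric] by (simp add: inner_prod_def inner_axis')
    have f3: "f3 X = f1 X * exp (B * ((dist X (c, 0))\<^sup>2 - l\<^sup>2))" for X
    proof -
      have "(X - (c, 0)) \<bullet> (X - (c, 0)) = (dist X (c, 0))\<^sup>2"
        unfolding dist_norm power2_norm_eq_inner ..
      moreover have "(0, - M) \<bullet> X = - M * snd X" by (simp add: inner_prod_def)
      ultimately show ?thesis
        unfolding f1 f3_def exp_add[symmetric] by (simp add: algebra_simps)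
    qed
    define \<psi> where "\<psi> X = 3 * f1 X + (-1) * (1 * f2 X + 1 * f3 X)" for X
    have \<psi>_pos: "0 < \<psi> X" if "X \<in> cap l" for X
    proof -
      have X: "0 \<le> fst X $ k" "dist X (c, 0) \<le> l" using that by (auto simp: cap_def mem_closed_quarter)
      have "exp (- B * fst X $ k) \<le> 1" using X B0 by simp
      moreover have "(dist X (c, 0))\<^sup>2 \<le> l\<^sup>2" using X by (intro power_mono) auto
      then have "exp (B * ((dist X (c, 0))\<^sup>2 - l\<^sup>2)) \<le> 1" using B0 by (simp add: mult_le_0_iff)
      ultimately have "0 < 3 - (exp (- B * fst X $ k) + exp (B * ((dist X (c, 0))\<^sup>2 - l\<^sup>2)))" by linarith
      then have "0 < f1 X * (3 - (exp (- B * fst X $ k) + exp (B * ((dist X (c, 0))\<^sup>2 - l\<^sup>2))))"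
        by (intro mult_pos_pos) (simp_all add: f1)
      then show ?thesis by (simp add: \<psi>_def f2 f3 algebra_simps)
    qed
    have "continuous_on (cap l) (\<lambda>X. excess l X / \<psi> X)"
      using \<psi>_pos unfolding \<psi>_def f1_def f2_def f3_def
      by (intro continuous_intros continuous_on_excess_cap) force
    then obtain X0 where X0: "X0 \<in> cap l" "\<And>X. X \<in> cap l \<Longrightarrow> excess l X0 / \<psi> X0 \<le> excess l X / \<psi> X"
      using continuous_attains_inf[OF compact_cap] ex by blast
    define m where "m = excess l X0 / \<psi> X0"
    have "m \<le> excess l X / \<psi> X" using X0(2)[OF ex(1)] by (simp add: m_def)
    also have "\<dots> < 0" using ex \<psi>_pos by (simp add: divide_neg_pos)
    finally have m: "m < 0" .
    have w0: "excess l X0 = m * \<psi> X0" using \<psi>_pos[OF X0(1)] by (simp add: m_def)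
    then have neg: "excess l X0 < 0" using m \<psi>_pos[OF X0(1)] by (simp add: mult_neg_pos)
    have X0q: "X0 \<in> closed_quarter k" "dist X0 (c, 0) \<le> l" using X0(1) by (auto simp: cap_def)
    have lt: "dist X0 (c, 0) < l" using excess_sphere[OF X0q(1), of l] neg X0q(2) by (cases "dist X0 (c, 0) = l") auto
    have kpos: "0 < fst X0 $ k" using excess_face[OF X0(1) lt] neg X0q(1) by (force simp: mem_closed_quarter)
    define v where "v X = 1 * excess l X + (- m) * \<psi> X" for X
    define V where "V = {X. dist X (c, 0::real) < l}"
    have V: "open V" "X0 \<in> V" unfolding V_def by (auto intro!: open_Collect_less continuous_intros lt)
    have vmin: "v X0 \<le> v X" if "X \<in> V" "X \<in> closed_quarter k" for X
    proof -
      have X: "X \<in> cap l" using that by (auto simp: V_def cap_def)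
      have "m * \<psi> X \<le> excess l X" using X0(2)[OF X] \<psi>_pos[OF X] by (simp add: m_def[symmetric] field_simps)
      then show ?thesis by (simp add: v_def w0)
    qed
    show ?thesis
    proof (cases "0 < snd X0")
      case True
      then have Q: "X0 \<in> quarter_space k" using kpos by (simp add: mem_quarter_space)
      define y where "y = snd X0"
      define d where "d = dist X0 (c, 0)"
      define N where "N = real DIM((real ^ 'n) \<times> real)"
      define g2 where "g2 = exp (- B * fst X0 $ k)"
      define g3 where "g3 = exp (B * (d\<^sup>2 - l\<^sup>2))"
      have ad: "a \<le> d" using dist_centre(2)[OF X0q(1), of 0] by (simp add: a_def d_def)
      have yd: "0 < y" "y \<le> d" using True dist_snd_le[of X0 "(c, 0)"] by (auto simp: y_def d_def)
      let ?L1 = "((norm ((0, - M) + (2 * 0) *\<^sub>R (X0 - 0)))\<^sup>2 + 2 * 0 * N) * f1 X0"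
      let ?L2 = "((norm (((- B) *\<^sub>R axis k 1, - M) + (2 * 0) *\<^sub>R (X0 - 0)))\<^sup>2 + 2 * 0 * N) * f2 X0"
      let ?L3 = "((norm ((0, - M) + (2 * B) *\<^sub>R (X0 - (c, 0))))\<^sup>2 + 2 * B * N) * f3 X0"
      have "has_laplacian v (1 * 0 + (- m) * (3 * ?L1 + (-1) * (1 * ?L2 + 1 * ?L3))) X0"
        unfolding v_def \<psi>_def f1_def f2_def f3_def N_def
        by (intro has_laplacian_lincomb has_laplacian_exp_quadratic excess_laplacian Q X0)
      from interior_min_laplacian_nonneg[OF this V Q vmin]
      have L: "0 \<le> 3 * ?L1 - ?L2 - ?L3" using m by (simp add: zero_le_mult_iff mult_le_0_iff)
      have n1: "(norm ((0, - M) + (2 * 0) *\<^sub>R (X0 - 0)))\<^sup>2 = M\<^sup>2"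
        by (simp add: norm_Pair)
      have n2: "(norm (((- B) *\<^sub>R axis k 1, - M) + (2 * 0) *\<^sub>R (X0 - 0)))\<^sup>2 = B\<^sup>2 + M\<^sup>2"
        by (simp add: norm_Pair)
      have n3: "(norm ((0, - M) + (2 * B) *\<^sub>R (X0 - (c, 0))))\<^sup>2 = M\<^sup>2 - 4 * B * M * y + 4 * B\<^sup>2 * d\<^sup>2"
      proof -
        have "(norm ((0, - M) + (2 * B) *\<^sub>R (X0 - (c, 0))))\<^sup>2
          = (norm (0 :: real ^ 'n, - M))\<^sup>2 + 2 * ((0, - M) \<bullet> ((2 * B) *\<^sub>R (X0 - (c, 0)))) + (norm ((2 * B) *\<^sub>R (X0 - (c, 0))))\<^sup>2"
          unfolding power2_norm_eq_inner by (simp only: inner_add_left inner_add_right inner_commute)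
        then show ?thesis by (simp add: norm_Pair y_def d_def dist_norm power_mult_distrib inner_prod_def)
      qed
      have "3 * ?L1 - ?L2 - ?L3 = f1 X0 * (3 * M\<^sup>2 - (B\<^sup>2 + M\<^sup>2) * g2 - (M\<^sup>2 - 4 * B * M * y + 4 * B\<^sup>2 * d\<^sup>2 + 2 * B * N) * g3)"
        unfolding n1 n2 n3 f2 f3 g2_def g3_def d_def by (simp add: algebra_simps)
      then have key: "0 \<le> 3 * M\<^sup>2 - (B\<^sup>2 + M\<^sup>2) * g2 - (M\<^sup>2 - 4 * B * M * y + 4 * B\<^sup>2 * d\<^sup>2 + 2 * B * N) * g3"
        using L by (simp add: f1 zero_le_mult_iff)
      have g: "0 < g2" "0 < g3" by (auto simp: g2_def g3_def)
      \<comment> \<open>If \<open>x\<^sub>k\<close> or \<open>l\<^sup>2 - d\<^sup>2\<close> is below \<open>1 / B\<close>, then \<open>g2\<close> or \<open>g3\<close> respectively exceeds \<open>1 / e > 1 / 3\<close>.\<close>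
      have e3: "1 / 3 < exp r" if "- 1 < r" for r :: real
      proof -
        have "exp (- 1) < exp r" using that by simp
        moreover have "1 / 3 \<le> exp (- 1 :: real)" using exp_le by (simp add: exp_minus field_simps)
        ultimately show ?thesis by linarith
      qed
      have BM: "9 * M\<^sup>2 < B\<^sup>2"
        using B(1) M power_strict_mono[of "3 * M" B 2] by (simp add: power_mult_distrib)
      have "B * a \<le> B * d" using ad B0 by simp
      then have Bd: "3 * M < B * d" using B by linarith
      \<comment> \<open>The cross term of the two exponents in \<open>f3\<close> is absorbed by a square, since \<open>y \<le> d\<close>.\<close>
      have "0 \<le> (M - 2 * B * y)\<^sup>2" by simp
      then have sq: "0 \<le> M\<^sup>2 - 4 * B * M * y + 4 * B\<^sup>2 * y\<^sup>2"
        by (simp add: power2_eq_square algebra_simps)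
      have "4 * B\<^sup>2 * y\<^sup>2 \<le> 4 * B\<^sup>2 * d\<^sup>2"
        using yd by (intro mult_left_mono power_mono) auto
      then have c3: "0 \<le> M\<^sup>2 - 4 * B * M * y + 4 * B\<^sup>2 * d\<^sup>2 + 2 * B * N"
      proof -
        have "0 \<le> 2 * B * N" using B0 by (simp add: N_def)
        then show ?thesis using sq \<open>4 * B\<^sup>2 * y\<^sup>2 \<le> 4 * B\<^sup>2 * d\<^sup>2\<close> by linarith
      qed
      define P2 where "P2 = (B\<^sup>2 + M\<^sup>2) * g2"
      define coeff3 where "coeff3 = M\<^sup>2 - 4 * B * M * y + 4 * B\<^sup>2 * d\<^sup>2 + 2 * B * N"
      define P3 where "P3 = coeff3 * g3"
      have weighted: "P2 + P3 \<le> 3 * M\<^sup>2" using key by (simp add: P2_def P3_def coeff3_def)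
      have P: "0 \<le> P2" "0 \<le> P3" using g c3 by (auto simp: P2_def P3_def coeff3_def)
      have M2: "0 < M\<^sup>2" using M by simp
      have "1 / B \<le> fst X0 $ k"
      proof (rule ccontr)
        assume "\<not> 1 / B \<le> fst X0 $ k"
        then have "1 / 3 < g2" using B0 unfolding g2_def by (intro e3) (simp add: field_simps)
        then have "(B\<^sup>2 + M\<^sup>2) * (1 / 3) \<le> P2" unfolding P2_def by (intro mult_left_mono) auto
        then have "B\<^sup>2 + M\<^sup>2 \<le> 3 * P2" by simp
        then show False using weighted P M2 BM by linarith
      qed
      moreover have "1 / B \<le> l\<^sup>2 - d\<^sup>2"
      proof (rule ccontr)
        assume "\<not> 1 / B \<le> l\<^sup>2 - d\<^sup>2"
        then have "1 / 3 < g3" using B0 unfolding g3_def by (intro e3) (simp add: field_simps)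
        then have "coeff3 * (1 / 3) \<le> P3"
          unfolding P3_def using c3 by (intro mult_left_mono) (auto simp: coeff3_def)
        then have "coeff3 \<le> 3 * P3" by simp
        moreover have "9 * M\<^sup>2 < coeff3"
        proof -
          have "B * M * y \<le> B * M * d" using yd B0 M by (intro mult_left_mono) auto
          moreover have "(3 * M) * (2 * M) < (B * d) * (B * d - M)"
            by (rule mult_strict_mono) (use Bd M in linarith)+
          moreover have "0 \<le> B * N" using B0 by (simp add: N_def)
          ultimately show ?thesis using M2 by (simp add: coeff3_def power2_eq_square algebra_simps)
        qed
        ultimately show False using weighted P by linarith
      qed
      ultimately show ?thesis using X0(1) neg unfolding d_def by blast
    next
      case False
      then obtain x where x: "X0 = (x, 0)" using X0q(1) by (cases X0) (auto simp: mem_closed_quarter)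
      have xk: "0 < x $ k" using kpos x by simp
      obtain d where d: "kelvin (c, 0) l u (x, 0) powr p \<le> d"
        "has_normal_derivative (kelvin (c, 0) l u) d (0, -1) (x, 0)"
        using kelvin_neumann[of x l] lt xk x by auto
      have dw: "has_normal_derivative (excess l) (1 * d + (-1) * u (x, 0) powr p) (0, -1) (x, 0)"
        using has_normal_derivative_lincomb[OF d(2) neumann[OF xk], of 1 "-1"]
        by (simp add: excess_def[abs_def])
      let ?e1 = "(((0, - M) + (2 * 0) *\<^sub>R ((x, 0) - 0)) \<bullet> (0, -1)) * f1 (x, 0)"
      let ?e2 = "((((- B) *\<^sub>R axis k 1, - M) + (2 * 0) *\<^sub>R ((x, 0) - 0)) \<bullet> (0, -1)) * f2 (x, 0)"
      let ?e3 = "(((0, - M) + (2 * B) *\<^sub>R ((x, 0) - (c, 0))) \<bullet> (0, -1)) * f3 (x, 0)"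
      have "has_normal_derivative v (1 * (1 * d + (-1) * u (x, 0) powr p)
          + (- m) * (3 * ?e1 + (-1) * (1 * ?e2 + 1 * ?e3))) (0, -1) (x, 0)"
        unfolding v_def \<psi>_def f1_def f2_def f3_def
        by (intro has_normal_derivative_lincomb has_normal_derivative_exp_quadratic dw)
      from bottom_min_normal_derivative_nonpos[OF this V(1), of k]
      have "1 * (1 * d + (-1) * u (x, 0) powr p) + (- m) * (3 * ?e1 + (-1) * (1 * ?e2 + 1 * ?e3)) \<le> 0"
        using V(2) xk vmin unfolding x by fastforce
      moreover have "3 * ?e1 + (-1) * (1 * ?e2 + 1 * ?e3) = M * \<psi> (x, 0)"
        by (simp add: \<psi>_def algebra_simps)
      ultimately have "d - u (x, 0) powr p \<le> M * excess l (x, 0)"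
        using w0 by (simp add: x mult.left_commute)
      moreover have "(M - 1) * excess l (x, 0) \<le> d - u (x, 0) powr p"
      proof -
        have l0: "0 \<le> l" using X0q(2) by (meson order_trans zero_le_dist)
        have "0 \<le> kelvin (c, 0) l u (x, 0)" using kelvin_nonneg[OF l0 X0(1)] by (simp add: x)
        moreover have "kelvin (c, 0) l u (x, 0) \<le> u (x, 0)" using neg by (simp add: excess_def x)
        moreover have "u (x, 0) \<le> U" using U(2)[of "(l, X0)"] X0(1) l by (auto simp: x)
        ultimately have "u (x, 0) powr p - kelvin (c, 0) l u (x, 0) powr p
            \<le> p * U powr (p - 1) * (u (x, 0) - kelvin (c, 0) l u (x, 0))"
          using powr_diff_le p_ge_1 U(1) by blast
        then show ?thesis using d(1) by (simp add: M_def excess_def algebra_simps)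
      qed
      ultimately have "0 \<le> excess l (x, 0)" by (simp add: algebra_simps)
      then show ?thesis using neg x by simp
    qed
  qed
  show ?thesis by (rule that[OF B0]) (rule core)
qed

text \<open>Consider the smallest radius \<open>l0\<close> for which \<open>excess l0 \<le> 0\<close> somewhere in the core of its cap. No smaller
  radius is bad, so \<open>excess l0\<close> is nonnegative in its cap by continuity in the radius, and by
  \<open>excess_positive\<close> it cannot vanish in the core.\<close>

lemma solution_le_kelvin:
  assumes "X \<in> cap l"
  shows "u X \<le> kelvin (c, 0) l u X"
proof (rule ccontr)
  assume "\<not> u X \<le> kelvin (c, 0) l u X"
  then have X: "excess l X < 0" by (simp add: excess_def)
  obtain B where B: "0 < B" and core: "\<And>l' X. l' \<le> l \<Longrightarrow> X \<in> cap l' \<Longrightarrow> excess l' X < 0 \<Longrightarrow>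
      \<exists>X\<in>cap l'. excess l' X < 0 \<and> 1 / B \<le> fst X $ k \<and> 1 / B \<le> l'\<^sup>2 - (dist X (c, 0))\<^sup>2"
    using negative_somewhere_in_core[of l] by metis
  define S where "S = {(l, X). X \<in> cap l} \<inter> {Y. fst Y \<le> l}"
  define P where "P = {Y. 1 / B \<le> fst (snd Y) $ k \<and> 1 / B \<le> (fst Y)\<^sup>2 - (dist (snd Y) (c, 0::real))\<^sup>2}"
  define Q where "Q = {(l, X). X \<in> cap l} \<inter> (\<lambda>Y. excess (fst Y) (snd Y)) -` {..0}"
  have "closed P"
    unfolding P_def by (intro closed_Collect_conj closed_Collect_le continuous_intros)
  moreover have "closed Q"
    unfolding Q_def by (intro continuous_closed_preimage continuous_on_excess closed_caps closed_atMost)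
  ultimately have comp: "compact (S \<inter> (P \<inter> Q))"
    unfolding S_def by (intro compact_Int_closed compact_caps closed_Int)
  have SPQ: "(l', Y) \<in> S \<inter> (P \<inter> Q) \<longleftrightarrow> l' \<le> l \<and> Y \<in> cap l' \<and> excess l' Y \<le> 0 \<and>
      1 / B \<le> fst Y $ k \<and> 1 / B \<le> l'\<^sup>2 - (dist Y (c, 0))\<^sup>2" for l' Y
    by (auto simp: S_def P_def Q_def)
  obtain X1 where "X1 \<in> cap l" "excess l X1 < 0" "1 / B \<le> fst X1 $ k" "1 / B \<le> l\<^sup>2 - (dist X1 (c, 0))\<^sup>2"
    using core[OF order_refl assms X] by blast
  then have "(l, X1) \<in> S \<inter> (P \<inter> Q)" unfolding SPQ by simp
  then have ne: "S \<inter> (P \<inter> Q) \<noteq> {}" by blast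
  have "continuous_on (S \<inter> (P \<inter> Q)) fst" by (intro continuous_intros)
  from continuous_attains_inf[OF comp ne this]
  obtain Y0 where Y0: "Y0 \<in> S \<inter> (P \<inter> Q)" "\<And>Y. Y \<in> S \<inter> (P \<inter> Q) \<Longrightarrow> fst Y0 \<le> fst Y"
    by blast
  obtain l0 X0 where Y0_eq: "Y0 = (l0, X0)" by (cases Y0)
  have l0: "l0 \<le> l" and X0: "X0 \<in> cap l0" "excess l0 X0 \<le> 0" "1 / B \<le> fst X0 $ k" "1 / B \<le> l0\<^sup>2 - (dist X0 (c, 0))\<^sup>2"
    using Y0(1) unfolding Y0_eq SPQ by auto
  have good: "0 \<le> excess l' Y" if below: "l' < l0" "Y \<in> cap l'" for l' Y
  proof (rule ccontr)
    assume "\<not> 0 \<le> excess l' Y"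
    then have "excess l' Y < 0" by simp
    moreover have "l' \<le> l" using below l0 by simp
    ultimately obtain Z where "Z \<in> cap l'" "excess l' Z < 0" "1 / B \<le> fst Z $ k" "1 / B \<le> l'\<^sup>2 - (dist Z (c, 0))\<^sup>2"
      using core below(2) by blast
    then have "(l', Z) \<in> S \<inter> (P \<inter> Q)" unfolding SPQ using below l0 by simp
    from Y0(2)[OF this] show False using below by (simp add: Y0_eq)
  qed
  have "0 \<le> excess l0 Y" if Y: "Y \<in> cap l0" for Y
  proof (cases "dist Y (c, 0) = l0")
    case True
    then show ?thesis using excess_sphere[of Y l0] Y by (simp add: cap_def)
  next
    case False
    define r where "r = dist Y (c, 0)"
    have r: "r < l0" "Y \<in> closed_quarter k" using Y False by (auto simp: cap_def r_def)
    have "continuous_on {r..l0} (\<lambda>l. (\<lambda>Y. excess (fst Y) (snd Y)) (l, Y))"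
      by (rule continuous_on_compose2[OF continuous_on_excess])
        (intro continuous_intros, use r in \<open>auto simp: cap_def r_def\<close>)
    then have "continuous_on {r..l0} (\<lambda>l. excess l Y)" by simp
    then have "((\<lambda>l. excess l Y) \<longlongrightarrow> excess l0 Y) (at l0 within {r..l0})"
      using r by (simp add: continuous_on_def)
    then have lim: "((\<lambda>l. excess l Y) \<longlongrightarrow> excess l0 Y) (at_left l0)"
      using r by (simp add: at_within_Icc_at_left)
    have "\<forall>\<^sub>F l in at_left l0. 0 \<le> excess l Y"
      using eventually_at_leftI[of r l0 "\<lambda>l. 0 \<le> excess l Y"] r good by (auto simp: cap_def r_def)
    then show ?thesis using tendsto_lowerbound[OF lim] by simp
  qed
  moreover have "0 < fst X0 $ k" using X0(3) B by (meson divide_pos_pos less_le_trans zero_less_one)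
  moreover have "dist X0 (c, 0) < l0"
  proof -
    have "0 < 1 / B" using B by simp
    then have "dist X0 (c, 0) \<noteq> l0" using X0(4) by auto
    then show ?thesis using X0(1) by (auto simp: cap_def)
  qed
  ultimately have "0 < excess l0 X0" using excess_positive[OF _ X0(1)] by blast
  then show False using X0(2) by simp
qed

end

section \<open>Monotonicity on the bottom\<close>

context quarter_space_solution
begin

text \<open>The centre \<open>c = x - s (z - x)\<close> lies outside the domain for large \<open>s\<close>, and the inversion with
  \<open>l\<^sup>2 = dist x c \<cdot> dist z c\<close> sends \<open>x\<close> to \<open>z\<close>. The conformal factor is a power of \<open>\<surd>(1 + 1 / s)\<close>.\<close>

lemma increasing_on_bottom:
  assumes x: "0 < x $ k" and z: "x $ k < z $ k"
  shows "u (x, 0) \<le> u (z, 0)"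
proof -
  define d where "d = norm (z - x)"
  have "z \<noteq> x" using z by auto
  then have d: "d > 0" by (simp add: d_def)
  have ineq: "u (x, 0) \<le> sqrt (1 + inverse s) ^ (CARD('n) - 1) * u (z, 0)"
    if s: "x $ k / (z $ k - x $ k) < s" for s
  proof -
    have "0 < x $ k / (z $ k - x $ k)" using x z by simp
    then have s0: "0 < s" using s by linarith
    define c where "c = x - s *\<^sub>R (z - x)"
    have ck: "c $ k < 0" using s z by (simp add: c_def field_simps)
    interpret moving_sphere k p u c
      by unfold_locales (rule ck)
    define l where "l = d * sqrt (s * (s + 1))"
    have l2: "l\<^sup>2 = d\<^sup>2 * (s * (s + 1))" using s0 by (simp add: l_def power_mult_distrib)
    have nrm: "norm (x - c) = s * d" using s0 by (simp add: c_def d_def)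
    have dist: "dist (x, 0 :: real) (c, 0) = s * d" by (simp add: dist_Pair_Pair dist_norm nrm)
    have "s = sqrt (s * s)" using s0 by simp
    also have "\<dots> \<le> sqrt (s * (s + 1))" using s0 by (intro real_sqrt_le_mono mult_left_mono) auto
    finally have "s * d \<le> l" using d by (simp add: l_def mult.commute)
    then have "(x, 0) \<in> cap l" using x dist by (simp add: cap_def mem_closed_quarter)
    from solution_le_kelvin[OF this]
    have "u (x, 0) \<le> (l / (s * d)) ^ (CARD('n) - 1) * u (inversion l (x, 0))"
      by (simp add: kelvin_eq dist)
    moreover have "l / (s * d) = sqrt (1 + inverse s)"
    proof -
      have "l / (s * d) = sqrt (s * (s + 1)) / sqrt (s * s)" using d s0 by (simp add: l_def)
      also have "\<dots> = sqrt (1 + inverse s)"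
        unfolding real_sqrt_divide[symmetric] using s0 by (simp add: field_simps)
      finally show ?thesis .
    qed
    moreover have "inversion l (x, 0) = (z, 0)"
    proof -
      have "l\<^sup>2 / (norm ((x, 0 :: real) - (c, 0)))\<^sup>2 = (s + 1) / s"
      proof -
        have "norm ((x, 0 :: real) - (c, 0)) = s * d"
          using s0 d by (simp add: norm_Pair nrm)
        then show ?thesis
          unfolding l2 using s0 d by (simp add: power_mult_distrib power2_eq_square)
      qed
      moreover have "c + ((s + 1) / s) *\<^sub>R (x - c) = z"
      proof -
        have "((s + 1) / s) *\<^sub>R (x - c) = (s + 1) *\<^sub>R (z - x)" using s0 by (simp add: c_def)
        then show ?thesis by (simp add: c_def algebra_simps)
      qed
      ultimately show ?thesis by (simp add: inversion_def)
    qed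
    ultimately show ?thesis by simp
  qed
  have "((\<lambda>s. sqrt (1 + inverse s) ^ (CARD('n) - 1) * u (z, 0)) \<longlongrightarrow>
      sqrt (1 + 0) ^ (CARD('n) - 1) * u (z, 0)) at_top"
    by (intro tendsto_intros tendsto_inverse_0_at_top filterlim_ident)
  moreover have "\<forall>\<^sub>F s in at_top. u (x, 0) \<le> sqrt (1 + inverse s) ^ (CARD('n) - 1) * u (z, 0)"
    using eventually_gt_at_top[of "x $ k / (z $ k - x $ k)"] by eventually_elim (rule ineq)
  ultimately show ?thesis using tendsto_lowerbound by fastforce
qed

end

section \<open>Nonexistence\<close>

text \<open>The square of \<open>R\<^sup>2 - |x - z|\<^sup>2\<close> replaces the first Dirichlet eigenfunction of the ball: it is explicit,
  and subharmonic near the lateral boundary, where the vertical term carries a vanishing weight.\<close>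

lemma barrier_laplacian:
  fixes x z :: "real ^ 'n::finite"
  shows "has_laplacian (\<lambda>X. (R\<^sup>2 - (norm (fst X - z))\<^sup>2)\<^sup>2 * (exp (- \<kappa> * snd X) - E))
    ((8 * (norm (x - z))\<^sup>2 - 4 * real CARD('n) * (R\<^sup>2 - (norm (x - z))\<^sup>2)) * (exp (- \<kappa> * y) - E)
      + (R\<^sup>2 - (norm (x - z))\<^sup>2)\<^sup>2 * (\<kappa>\<^sup>2 * exp (- \<kappa> * y))) (x, y)"
proof -
  define q where "q = R\<^sup>2 - (norm (x - z))\<^sup>2"
  define f where "f = exp (- \<kappa> * y) - E"
  define s where "s b = (if snd b = 0 then (8 * ((x - z) \<bullet> fst b)\<^sup>2 - 4 * q) * f else q\<^sup>2 * (\<kappa>\<^sup>2 * exp (- \<kappa> * y)))"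
    for b :: "(real ^ 'n) \<times> real"
  show ?thesis
    unfolding has_laplacian_def
  proof (intro exI[of _ s] conjI ballI)
    fix b :: "(real ^ 'n) \<times> real"
    assume "b \<in> Basis"
    then consider (horizontal) e where "e \<in> Basis" "b = (e, 0)" | (vertical) "b = (0, 1)"
      by (auto simp: Basis_prod_def)
    then show "has_second_derivative (\<lambda>t. (R\<^sup>2 - (norm (fst ((x, y) + t *\<^sub>R b) - z))\<^sup>2)\<^sup>2
        * (exp (- \<kappa> * snd ((x, y) + t *\<^sub>R b)) - E)) (s b)"
    proof cases
      case horizontal
      define \<beta> where "\<beta> = (x - z) \<bullet> e"
      have "(norm (x + t *\<^sub>R e - z))\<^sup>2 = (norm (x - z))\<^sup>2 + 2 * t * \<beta> + t\<^sup>2" for t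
      proof -
        define w where "w = x - z"
        have e: "x + t *\<^sub>R e - z = w + t *\<^sub>R e" by (simp add: w_def)
        show ?thesis
          unfolding e \<beta>_def w_def[symmetric] power2_norm_eq_inner using horizontal(1)
          by (simp add: inner_simps inner_commute[of e w] power2_eq_square algebra_simps)
      qed
      then have line: "(R\<^sup>2 - (norm (fst ((x, y) + t *\<^sub>R b) - z))\<^sup>2)\<^sup>2 * (exp (- \<kappa> * snd ((x, y) + t *\<^sub>R b)) - E)
          = (q - 2 * t * \<beta> - t\<^sup>2)\<^sup>2 * f" for t
        by (simp add: horizontal(2) q_def f_def algebra_simps)
      have sb: "s b = (8 * \<beta>\<^sup>2 - 4 * q) * f" by (simp add: s_def horizontal(2) \<beta>_def)
      show ?thesis
        unfolding line sb
        by (rule has_second_derivativeI[where d = "\<lambda>t. 2 * (q - 2 * t * \<beta> - t\<^sup>2) * (- 2 * \<beta> - 2 * t) * f"])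
          (auto intro!: derivative_eq_intros simp: power2_eq_square algebra_simps)
    next
      case vertical
      have line: "(R\<^sup>2 - (norm (fst ((x, y) + t *\<^sub>R b) - z))\<^sup>2)\<^sup>2 * (exp (- \<kappa> * snd ((x, y) + t *\<^sub>R b)) - E)
          = q\<^sup>2 * (exp (- \<kappa> * (y + t)) - E)" for t
        by (simp add: vertical q_def)
      have sb: "s b = q\<^sup>2 * (\<kappa>\<^sup>2 * exp (- \<kappa> * y))" by (simp add: s_def vertical)
      show ?thesis
        unfolding line sb
        by (rule has_second_derivativeI[where d = "\<lambda>t. q\<^sup>2 * (- \<kappa> * exp (- \<kappa> * (y + t)))"])
          (auto intro!: derivative_eq_intros simp: power2_eq_square)
    qed
  next
    have "(\<Sum>e\<in>Basis. ((x - z) \<bullet> e)\<^sup>2) = (norm (x - z))\<^sup>2"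
      unfolding power2_norm_eq_inner by (subst euclidean_inner[of "x - z" "x - z"]) (simp add: power2_eq_square)
    moreover have "sum s Basis = (8 * (\<Sum>e\<in>Basis. ((x - z) \<bullet> e)\<^sup>2) - 4 * real CARD('n) * q) * f + q\<^sup>2 * (\<kappa>\<^sup>2 * exp (- \<kappa> * y))"
    proof -
      have "sum s Basis = (\<Sum>e\<in>Basis. s (e, 0)) + (\<Sum>e\<in>Basis. s (0, e))"
        unfolding Basis_prod_def
        by (subst sum.union_disjoint) (auto simp: sum.reindex inj_on_def)
      then show ?thesis by (simp add: s_def sum_subtractf flip: sum_distrib_left sum_distrib_right)
    qed
    ultimately show "(8 * (norm (x - z))\<^sup>2 - 4 * real CARD('n) * (R\<^sup>2 - (norm (x - z))\<^sup>2)) * (exp (- \<kappa> * y) - E)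
      + (R\<^sup>2 - (norm (x - z))\<^sup>2)\<^sup>2 * (\<kappa>\<^sup>2 * exp (- \<kappa> * y)) = sum s Basis"
      by (simp add: q_def f_def)
  qed
qed

lemma barrier_normal_derivative:
  fixes x z :: "real ^ 'n::finite"
  shows "has_normal_derivative (\<lambda>X. (R\<^sup>2 - (norm (fst X - z))\<^sup>2)\<^sup>2 * (exp (- \<kappa> * snd X) - E))
    ((R\<^sup>2 - (norm (x - z))\<^sup>2)\<^sup>2 * \<kappa>) (0, -1) (x, 0)"
  unfolding has_normal_derivative_def by (auto intro!: derivative_eq_intros)

text \<open>With \<open>q = R\<^sup>2 - |x - z|\<^sup>2\<close> and \<open>\<kappa> R = n + 2\<close> the Laplacian of the barrier \<open>\<phi>\<close> is at least
  \<open>((\<kappa> q - 2 R)\<^sup>2 + 4 R\<^sup>2) f > 0\<close> where \<open>f\<close> is its vertical factor. On the bottom the normal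
  derivative of \<open>\<phi>\<close> is \<open>\<kappa> q\<^sup>2 \<le> 2 \<kappa> \<phi>\<close>. The touching point of \<open>u\<close> with \<open>t \<phi>\<close> is found by
  maximizing \<open>\<phi> / u\<close>.\<close>

lemma (in quarter_space_solution) no_solution: False
proof -
  define n where "n = real CARD('n)"
  have n: "n > 0" by (simp add: n_def)
  define \<delta> where "\<delta> = u (axis k 1, 0)"
  have \<delta>: "\<delta> > 0" unfolding \<delta>_def by (rule positive_bottom) simp
  have u_ge: "\<delta> \<le> u (x, 0)" if "1 < x $ k" for x
    unfolding \<delta>_def using that by (intro increasing_on_bottom) auto
  define \<kappa> where "\<kappa> = \<delta> powr (p - 1) / 4"
  have \<kappa>: "\<kappa> > 0" "2 * \<kappa> < \<delta> powr (p - 1)" using \<delta> by (auto simp: \<kappa>_def)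
  define R where "R = (n + 2) / \<kappa>"
  have R: "R > 0" "\<kappa> * R = n + 2" using \<kappa> n by (auto simp: R_def)
  define E where "E = exp (- \<kappa> * R)"
  have E: "0 < E" "2 * E \<le> 1"
  proof -
    show "0 < E" by (simp add: E_def)
    have "2 \<le> exp (\<kappa> * R)" using exp_ge_add_one_self[of "\<kappa> * R"] R n by linarith
    then show "2 * E \<le> 1" by (simp add: E_def exp_minus field_simps)
  qed
  \<comment> \<open>The ball of radius \<open>R\<close> about \<open>z\<close> lies in \<open>x\<^sub>k \<ge> 2\<close>, where the lower bound \<open>\<delta>\<close> applies.\<close>
  define z :: "real ^ 'n" where "z = axis k (R + 2)"
  define \<phi> where "\<phi> X = (R\<^sup>2 - (norm (fst X - z))\<^sup>2)\<^sup>2 * (exp (- \<kappa> * snd X) - E)" for X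
  define D where "D = cball z R \<times> {0..R}"
  have D_k: "1 < fst X $ k" if "X \<in> D" for X
  proof -
    have "norm (fst X - z) \<le> R" using that by (auto simp: D_def dist_norm norm_minus_commute)
    then have "\<bar>(fst X - z) $ k\<bar> \<le> R" using component_le_norm_cart order_trans by blast
    then show ?thesis by (simp add: z_def)
  qed
  have D_closed: "X \<in> closed_quarter k" if "X \<in> D" for X
    using D_k[OF that] that by (auto simp: mem_closed_quarter D_def)
  have u_pos: "0 < u X" if "X \<in> D" for X
    using D_k[OF that] D_closed[OF that] by (intro positive_off_face) auto
  have zD: "(z, 0) \<in> D" using R by (simp add: D_def)
  have "continuous_on D u" using continuous by (rule continuous_on_subset) (use D_closed in blast)
  then have "continuous_on D (\<lambda>X. \<phi> X / u X)"
    unfolding \<phi>_def using u_pos by (intro continuous_intros) force+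
  moreover have "compact D" unfolding D_def by (intro compact_Times compact_cball compact_Icc)
  ultimately obtain X0 where X0: "X0 \<in> D" "\<And>X. X \<in> D \<Longrightarrow> \<phi> X / u X \<le> \<phi> X0 / u X0"
    using continuous_attains_sup[of D "\<lambda>X. \<phi> X / u X"] zD by blast
  have "0 < \<phi> (z, 0)" using R E by (simp add: \<phi>_def)
  then have "0 < \<phi> (z, 0) / u (z, 0)" using u_pos[OF zD] by simp
  then have "0 < \<phi> X0 / u X0" using X0(2)[OF zD] by linarith
  then have \<phi>0: "0 < \<phi> X0" using u_pos[OF X0(1)] by (simp add: zero_less_divide_iff)
  define t where "t = u X0 / \<phi> X0"
  have t: "t > 0" using \<phi>0 u_pos[OF X0(1)] by (simp add: t_def)
  have touch: "u X0 = t * \<phi> X0" using \<phi>0 by (simp add: t_def)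
  define v where "v X = 1 * u X + (- t) * \<phi> X" for X
  have v_min: "v X0 \<le> v X" if "X \<in> D" for X
  proof -
    have "t * \<phi> X \<le> u X"
      using X0(2)[OF that] u_pos[OF that] u_pos[OF X0(1)] \<phi>0 by (simp add: t_def field_simps)
    then show ?thesis by (simp add: v_def touch)
  qed
  obtain x y where X0_eq: "X0 = (x, y)" by (cases X0)
  have xy: "norm (x - z) \<le> R" "0 \<le> y" "y \<le> R"
    using X0(1) by (auto simp: X0_eq D_def dist_norm norm_minus_commute)
  define q where "q = R\<^sup>2 - (norm (x - z))\<^sup>2"
  have "q \<noteq> 0" "y \<noteq> R" using \<phi>0 by (auto simp: \<phi>_def X0_eq q_def E_def)
  then have lt: "norm (x - z) < R" "y < R" using xy by (auto simp: q_def less_le)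
  then have q: "q > 0" using power_strict_mono[of "norm (x - z)" R 2] by (simp add: q_def)
  have k: "1 < x $ k" using D_k[OF X0(1)] by (simp add: X0_eq)
  define U where "U = {X. norm (fst X - z) < R \<and> snd X < R}"
  have U: "open U" "X0 \<in> U"
    unfolding U_def by (auto intro!: open_Collect_conj open_Collect_less continuous_intros simp: X0_eq lt)
  have UD: "X \<in> D" if "X \<in> U" "X \<in> closed_quarter k" for X
    using that by (cases X) (auto simp: U_def D_def mem_closed_quarter dist_norm norm_minus_commute)
  have v_min': "v X0 \<le> v X" if "X \<in> U" "X \<in> closed_quarter k" for X
    using that by (intro v_min UD)
  show False
  proof (cases "0 < y")
    case True
    then have Q: "X0 \<in> quarter_space k" using k by (simp add: X0_eq mem_quarter_space)
    define f where "f = exp (- \<kappa> * y) - E"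
    have f: "f > 0" using lt \<kappa> by (simp add: f_def E_def)
    let ?L = "(8 * (norm (x - z))\<^sup>2 - 4 * n * q) * f + q\<^sup>2 * (\<kappa>\<^sup>2 * exp (- \<kappa> * y))"
    have "has_laplacian \<phi> ?L X0"
      unfolding \<phi>_def[abs_def] X0_eq q_def f_def n_def by (rule barrier_laplacian)
    then have "has_laplacian v (1 * 0 + (- t) * ?L) X0"
      unfolding v_def[abs_def] by (intro has_laplacian_lincomb has_laplacian_0 Q)
    from interior_min_laplacian_nonneg[OF this U Q v_min']
    have "?L \<le> 0" using t by (simp add: mult_le_0_iff)
    moreover have "?L = ((\<kappa> * q - 2 * R)\<^sup>2 + 4 * R\<^sup>2) * f + q\<^sup>2 * (\<kappa>\<^sup>2 * E)"
    proof -
      have "exp (- \<kappa> * y) = f + E" by (simp add: f_def)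
      moreover have "(norm (x - z))\<^sup>2 = R\<^sup>2 - q" by (simp add: q_def)
      moreover have "n = \<kappa> * R - 2" using R by simp
      ultimately show ?thesis by (simp only:) (simp add: power2_eq_square algebra_simps)
    qed
    moreover have "0 < ((\<kappa> * q - 2 * R)\<^sup>2 + 4 * R\<^sup>2) * f" using R f by (intro mult_pos_pos add_nonneg_pos) auto
    moreover have "0 < q\<^sup>2 * (\<kappa>\<^sup>2 * E)" using q \<kappa> E by simp
    ultimately show False by linarith
  next
    case False
    then have y: "y = 0" using xy by simp
    have kpos: "0 < x $ k" using k by simp
    have "has_normal_derivative \<phi> (q\<^sup>2 * \<kappa>) (0, -1) (x, 0)"
      unfolding \<phi>_def[abs_def] q_def by (rule barrier_normal_derivative)
    then have "has_normal_derivative v (1 * u (x, 0) powr p + (- t) * (q\<^sup>2 * \<kappa>)) (0, -1) (x, 0)"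
      unfolding v_def[abs_def] by (intro has_normal_derivative_lincomb neumann kpos)
    from bottom_min_normal_derivative_nonpos[OF this U(1), of k]
    have "u (x, 0) powr p \<le> t * (q\<^sup>2 * \<kappa>)"
      using U(2) kpos v_min' unfolding X0_eq y by fastforce
    also have "\<dots> \<le> t * (q\<^sup>2 * (2 * \<kappa> * (1 - E)))"
    proof -
      have "\<kappa> * 1 \<le> \<kappa> * (2 * (1 - E))" using \<kappa> E by (intro mult_left_mono) auto
      then have "\<kappa> \<le> 2 * \<kappa> * (1 - E)" by (simp add: algebra_simps)
      then show ?thesis using t by (intro mult_left_mono) auto
    qed
    also have "\<dots> = 2 * \<kappa> * u (x, 0)"
      using touch by (simp add: X0_eq y \<phi>_def q_def)
    also have "\<dots> < \<delta> powr (p - 1) * u (x, 0)"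
      using \<kappa> u_ge[OF k] \<delta> by (intro mult_strict_right_mono) auto
    also have "\<dots> \<le> u (x, 0) powr (p - 1) * u (x, 0)"
      using u_ge[OF k] \<delta> p_ge_1 by (intro mult_right_mono powr_mono2) auto
    also have "\<dots> = u (x, 0) powr p"
      using u_ge[OF k] \<delta> by (simp add: powr_diff)
    finally show False by simp
  qed
qed

theorem theorem1p2:
  fixes k :: "'n::finite" and p :: real
  assumes "1 \<le> p"
    and "CARD('n) \<ge> 2 \<Longrightarrow> p \<le> (real CARD('n) + 1) / (real CARD('n) - 1)"
  shows "\<not> (\<exists>u :: (real ^ 'n) \<times> real \<Rightarrow> real. classical_solution k p u)"
proof
  assume "\<exists>u :: (real ^ 'n) \<times> real \<Rightarrow> real. classical_solution k p u"
  then obtain u :: "(real ^ 'n) \<times> real \<Rightarrow> real" where "classical_solution k p u" by blast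
  then have "quarter_space_solution k p u" using assms by unfold_locales
  then show False by (rule quarter_space_solution.no_solution)
qed

end
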